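(* Let $(u,y_0)$ be as defined in the context and set $$v(x):=u\big((u')^{-1}(-x)\big)+x\,(u')^{-1}(-x),\quad x>0,\qquad x_0:=\frac{\phi_0-y_0}{\rho y_0}.$$ Then $(v,x_0)$ satisfies the free-boundary problem $$\begin{cases}-\frac{\mu^2}{2\sigma^2}\frac{v'(x)^2}{v''(x)}+(r+\rho)xv'(x)-\delta v(x)+U(0)=0,&0<x<x_0,\\[1ex]-\frac{\mu^2}{2\sigma^2}\frac{v'(x)^2}{v''(x)}+G\big((1+\rho x)v'(x)\big)+(r+\rho)xv'(x)-\delta v(x)=0,&x\ge x_0,\\[1ex](1+\rho x_0)v'(x_0)=\phi_0,\\[1ex]\lim_{x\to0^+}\frac{v'(x)}{v''(x)}=0,\end{cases}$$ and the relations $$\begin{cases}(1+\rho x)v'(x)>\phi_0,&0<x<x_0,\\(1+\rho x_0)v'(x_0)=\phi_0,\\0<(1+\rho x)v'(x)<\phi_0,&x>x_0.\end{cases}$$ Moreover $v'(+\infty)=0$, $v'(0^+)=+\infty$, and for all $x>0$, $v'(x)=(u')^{-1}(-x)>0$ and $v''(x)=-1/u''\big(v'(x)\big)<0$.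
   Context: Constants: $r\ge0$ and $\mu,\sigma,\rho,\delta,\alpha>0$. Utility: $U_\pm\in\mathcal U:=\{f\in C^2(\mathbb R_+): f'>0,\ f''<0,\ f'(+\infty)=0,\ f(0)=0\}$; values at $0$ are understood as right limits at $0$ and $f'(0):=f'(0^+)\in(0,+\infty]$ may be infinite. The S-shaped utility is $U(c)=U_+(c-\alpha)$ for $c>\alpha$ and $U(c)=-U_-(\alpha-c)$ for $0\le c\le\alpha$; in particular $U(0)=-U_-(\alpha)$. Standing assumptions: (A1) $U_-(\alpha)\le\alpha U_+'(0)$; (A2) there exist constants $a_1,a_2,a_3>0$ and $a_4\ge0$ such that $U_+(x)\le a_1+xU_+'(x)+a_2U_+'(x)^{-a_4}$ for all $x>a_3$. $c_0\ge\alpha$ is the unique solution of $c_0U_+'(c_0-\alpha)-U_+(c_0-\alpha)=U_-(\alpha)$, and $\phi_0:=U_+'(c_0-\alpha)$. $(U_+')^{-1}$ is the inverse of $U_+'$, used on $(0,\phi_0]$, and $G(\phi):=U_+\big((U_+')^{-1}(\phi)\big)-\phi\big(\alpha+(U_+')^{-1}(\phi)\big)$ for $0<\phi\le\phi_0$. $$\lambda:=\frac{\sigma^2}{\mu^2}\left(\frac{\mu^2}{2\sigma^2}+r+\rho-\delta-\sqrt{\left(\frac{\mu^2}{2\sigma^2}+r+\rho-\delta\right)^2+2\delta\frac{\mu^2}{\sigma^2}}\right)<0.$$ $(y_0,\varphi,\psi)$ consists of a constant $y_0\in\left(\frac{\phi_0\lambda}{\lambda-1},\phi_0\right)$, an increasing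 $\varphi:(0,y_0]\to(0,\phi_0]$ and $\psi:(0,y_0]\to(0,1)$ satisfying, for $0<y\le y_0$, $$\varphi'(y)=\tfrac1y\varphi(y)(1-\psi(y)),$$ $$\psi'(y)=-\tfrac{2\rho\sigma^2}{\mu^2}\Big[\tfrac{1-\psi(y)}{y}\Big(\tfrac{\mu^2}{2\rho\sigma^2}\psi(y)-(U_+')^{-1}(\varphi(y))+\tfrac{r-\delta}{\rho}+1-\alpha\Big)-\tfrac{r+\rho}{\rho\varphi(y)}+\tfrac{\delta}{\rho y}\Big],$$ with $\varphi(y_0)=\phi_0$, $\psi(y_0)=\frac{2\sigma^2}{\phi_0\mu^2}\big(\frac\delta\lambda+r+\rho-\delta\big)(y_0-\phi_0)$, and such that $\lim_{y\to0+}\varphi(y)>0$ or $\lim_{y\to0+}\psi(y)=1$ (or both). Such a triple exists (this is established in the paper). $u:(0,\infty)\to\mathbb R$ is given by $$u(y)=\frac1\delta\Big[\frac{\mu^2}{2\rho\sigma^2}\varphi(y)\psi(y)+G(\varphi(y))+\frac{\delta-r-\rho}{\rho}(y-\varphi(y))\Big]\ (0<y\le y_0),\qquad u(y)=\frac{y_0-\phi_0}{\rho\lambda}\Big(\frac{y}{y_0}\Big)^\lambda+\frac{U(0)}{\delta}\ (y>y_0).$$ It is a $C^2$ strictly decreasing, strictly convex function with $u'(0^+)=-\infty$ and $u'(+\infty)=0$, so $(u')^{-1}:(-\infty,0)\to(0,\infty)$ is well defined. *)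

theory Defs
  imports "HOL-Analysis.Analysis"
begin

definition C2_on :: "(real \<Rightarrow> real) \<Rightarrow> real set \<Rightarrow> bool" where
  "C2_on f S \<longleftrightarrow>
     (\<forall>x\<in>S. f differentiable (at x)) \<and>
     (\<forall>x\<in>S. deriv f differentiable (at x)) \<and>
     continuous_on S (deriv (deriv f))"

text \<open>
  The class \<open>\<U>\<close> of utility functions. Smoothness and the sign conditions are imposed on the open
  half line. At \<open>0\<close> only the value is prescribed, and it is the right limit there.
  Values of \<open>f\<close> at negative arguments are irrelevant.
\<close>

definition utility :: "(real \<Rightarrow> real) \<Rightarrow> bool" where
  "utility f \<longleftrightarrow>
     C2_on f {0<..} \<and>
     (\<forall>x>0. deriv f x > 0) \<and>
     (\<forall>x>0. deriv (deriv f) x < 0) \<and>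
     (deriv f \<longlongrightarrow> 0) at_top \<and>
     f 0 = 0 \<and> (f \<longlongrightarrow> 0) (at_right 0)"

text \<open>
  The derivative \<open>f'\<close> on \<open>[0, \<infinity>)\<close>, with \<open>f'(0)\<close> read as the right limit of \<open>f'\<close>. That limit may be
  \<open>\<infinity>\<close>, which is why the values are extended reals.
\<close>

definition marginal :: "(real \<Rightarrow> real) \<Rightarrow> real \<Rightarrow> ereal" where
  "marginal f x =
     (if x = 0 then Lim (at_right 0) (\<lambda>t. ereal (deriv f t)) else ereal (deriv f x))"

text \<open>
  The inverse of \<open>f'\<close> with values in \<open>[0, \<infinity>)\<close>. The value \<open>0\<close> is attained at \<open>\<phi> = f'(0+)\<close> when that
  limit is finite.
\<close>

definition marginal_inv :: "(real \<Rightarrow> real) \<Rightarrow> real \<Rightarrow> real" where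
  "marginal_inv f \<phi> = inv_into {0..} (marginal f) (ereal \<phi>)"

definition S_utility :: "real \<Rightarrow> (real \<Rightarrow> real) \<Rightarrow> (real \<Rightarrow> real) \<Rightarrow> real \<Rightarrow> real" where
  "S_utility \<alpha> Up Um c = (if c > \<alpha> then Up (c - \<alpha>) else - Um (\<alpha> - c))"

definition G :: "real \<Rightarrow> (real \<Rightarrow> real) \<Rightarrow> real \<Rightarrow> real" where
  "G \<alpha> Up \<phi> = Up (marginal_inv Up \<phi>) - \<phi> * (\<alpha> + marginal_inv Up \<phi>)"

definition lam :: "real \<Rightarrow> real \<Rightarrow> real \<Rightarrow> real \<Rightarrow> real \<Rightarrow> real" where
  "lam r \<mu> \<sigma> \<rho> \<delta> =
     \<sigma>\<^sup>2 / \<mu>\<^sup>2 * (\<mu>\<^sup>2 / (2 * \<sigma>\<^sup>2) + r + \<rho> - \<delta>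
       - sqrt ((\<mu>\<^sup>2 / (2 * \<sigma>\<^sup>2) + r + \<rho> - \<delta>)\<^sup>2 + 2 * \<delta> * (\<mu>\<^sup>2 / \<sigma>\<^sup>2)))"

text \<open>
  The defining properties of \<open>(y\<^sub>0, \<phi>, \<psi>)\<close>. The functions live on \<open>(0, y\<^sub>0]\<close>, so the derivatives are
  taken within that interval and are one-sided at \<open>y\<^sub>0\<close>.
\<close>

definition dual_triple ::
  "real \<Rightarrow> real \<Rightarrow> real \<Rightarrow> real \<Rightarrow> real \<Rightarrow> real \<Rightarrow> (real \<Rightarrow> real) \<Rightarrow> real \<Rightarrow>
   real \<Rightarrow> (real \<Rightarrow> real) \<Rightarrow> (real \<Rightarrow> real) \<Rightarrow> bool" where
  "dual_triple r \<mu> \<sigma> \<rho> \<delta> \<alpha> Up \<phi>\<^sub>0 y\<^sub>0 \<phi> \<psi> \<longleftrightarrow>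
     \<phi>\<^sub>0 * lam r \<mu> \<sigma> \<rho> \<delta> / (lam r \<mu> \<sigma> \<rho> \<delta> - 1) < y\<^sub>0 \<and> y\<^sub>0 < \<phi>\<^sub>0 \<and>
     mono_on {0<..y\<^sub>0} \<phi> \<and>
     \<phi> ` {0<..y\<^sub>0} \<subseteq> {0<..\<phi>\<^sub>0} \<and>
     \<psi> ` {0<..y\<^sub>0} \<subseteq> {0<..<1} \<and>
     (\<forall>y\<in>{0<..y\<^sub>0}.
        (\<phi> has_real_derivative 1 / y * \<phi> y * (1 - \<psi> y)) (at y within {0<..y\<^sub>0})) \<and>
     (\<forall>y\<in>{0<..y\<^sub>0}.
        (\<psi> has_real_derivative
           - (2 * \<rho> * \<sigma>\<^sup>2 / \<mu>\<^sup>2) *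
             ((1 - \<psi> y) / y *
                (\<mu>\<^sup>2 / (2 * \<rho> * \<sigma>\<^sup>2) * \<psi> y - marginal_inv Up (\<phi> y) + (r - \<delta>) / \<rho> + 1 - \<alpha>)
              - (r + \<rho>) / (\<rho> * \<phi> y) + \<delta> / (\<rho> * y))) (at y within {0<..y\<^sub>0})) \<and>
     \<phi> y\<^sub>0 = \<phi>\<^sub>0 \<and>
     \<psi> y\<^sub>0 = 2 * \<sigma>\<^sup>2 / (\<phi>\<^sub>0 * \<mu>\<^sup>2) * (\<delta> / lam r \<mu> \<sigma> \<rho> \<delta> + r + \<rho> - \<delta>) * (y\<^sub>0 - \<phi>\<^sub>0) \<and>
     ((\<exists>L>0. (\<phi> \<longlongrightarrow> L) (at_right 0)) \<or> (\<psi> \<longlongrightarrow> 1) (at_right 0))"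

text \<open>The function \<open>u\<close>. It is meaningful for \<open>y > 0\<close> only.\<close>

definition dual_value ::
  "real \<Rightarrow> real \<Rightarrow> real \<Rightarrow> real \<Rightarrow> real \<Rightarrow> real \<Rightarrow> (real \<Rightarrow> real) \<Rightarrow> (real \<Rightarrow> real) \<Rightarrow> real \<Rightarrow>
   real \<Rightarrow> (real \<Rightarrow> real) \<Rightarrow> (real \<Rightarrow> real) \<Rightarrow> real \<Rightarrow> real" where
  "dual_value r \<mu> \<sigma> \<rho> \<delta> \<alpha> Up Um \<phi>\<^sub>0 y\<^sub>0 \<phi> \<psi> y =
     (if y \<le> y\<^sub>0
      then 1 / \<delta> * (\<mu>\<^sup>2 / (2 * \<rho> * \<sigma>\<^sup>2) * \<phi> y * \<psi> y + G \<alpha> Up (\<phi> y)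
             + (\<delta> - r - \<rho>) / \<rho> * (y - \<phi> y))
      else (y\<^sub>0 - \<phi>\<^sub>0) / (\<rho> * lam r \<mu> \<sigma> \<rho> \<delta>) * (y / y\<^sub>0) powr lam r \<mu> \<sigma> \<rho> \<delta>
             + S_utility \<alpha> Up Um 0 / \<delta>)"

definition deriv_inv :: "(real \<Rightarrow> real) \<Rightarrow> real \<Rightarrow> real" where
  "deriv_inv u = inv_into {0<..} (deriv u)"

definition primal_value :: "(real \<Rightarrow> real) \<Rightarrow> real \<Rightarrow> real" where
  "primal_value u x = u (deriv_inv u (- x)) + x * deriv_inv u (- x)"

end

theory Submission
  imports Defs
begin

text \<open>
  The ODE for \<open>\<psi>\<close> is arranged so that, together with the envelope identity \<open>G' = - (\<alpha> + I)\<close>, where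
  \<open>I = (U\<^sub>+')\<^sup>-\<^sup>1\<close>, everything cancels and \<open>u' = (y - \<phi>) / (\<rho> y)\<close>, \<open>u'' = \<phi> \<psi> / (\<rho> y\<^sup>2) > 0\<close> on
  \<open>(0, y\<^sub>0]\<close>. The boundary values of \<open>\<phi>\<close> and \<open>\<psi>\<close> at \<open>y\<^sub>0\<close> are those that glue this branch in \<open>C\<^sup>2\<close>
  fashion to the power branch. Then \<open>v\<close> is the Legendre transform of \<open>u\<close>: with \<open>y = v'(x)\<close> one has
  \<open>x = - u'(y)\<close>, \<open>v''(x) = - 1 / u''(y)\<close>, so that the equations for \<open>v\<close> no longer
  divide by a second derivative when written for \<open>u\<close>, and
  \<open>(1 + \<rho> x) v'(x) = y - \<rho> y u'(y)\<close> equals \<open>\<phi> y\<close> for \<open>y \<le> y\<^sub>0\<close>.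
\<close>

text \<open>Using the inequality at \<open>p\<close> and again with \<open>p\<close> and
  \<open>q\<close> exchanged traps \<open>g q - g p\<close> between \<open>(q - p) * m p\<close> and
  \<open>(q - p) * m q\<close>, so the difference quotient misses \<open>m p\<close> by at most
  \<open>\<bar>m q - m p\<bar>\<close>. The set \<open>S\<close> is arbitrary, which covers
  endpoints with one-sided derivatives.\<close>

lemma subgradient_has_derivative:
  fixes g m :: "real \<Rightarrow> real"
  assumes sub: "\<And>p q. p \<in> S \<Longrightarrow> q \<in> S \<Longrightarrow> g p + (q - p) * m p \<le> g q"
    and cont: "continuous (at p within S) m" and p: "p \<in> S"
  shows "(g has_real_derivative m p) (at p within S)"
proof -
  have m: "(m \<longlongrightarrow> m p) (at p within S)"
    using cont by (simp add: continuous_within)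
  have "norm ((g q - g p) / (q - p) - m p) \<le> \<bar>m q - m p\<bar>" if "q \<in> S" "q \<noteq> p" for q
  proof -
    have "g p + (q - p) * m p \<le> g q" "g q + (p - q) * m q \<le> g p"
      using sub that p by auto
    then have "\<bar>(g q - g p) - (q - p) * m p\<bar> \<le> \<bar>(q - p) * (m q - m p)\<bar>"
      by (simp add: algebra_simps)
    then have "\<bar>(g q - g p) - (q - p) * m p\<bar> / \<bar>q - p\<bar> \<le> \<bar>m q - m p\<bar>"
      using that by (simp add: abs_mult pos_divide_le_eq mult.commute)
    moreover have "(g q - g p) / (q - p) - m p = ((g q - g p) - (q - p) * m p) / (q - p)"
      using that by (simp add: field_simps)
    ultimately show ?thesis by simp
  qed
  then have "\<forall>\<^sub>F q in at p within S. norm ((g q - g p) / (q - p) - m p) \<le> \<bar>m q - m p\<bar>"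
    by (auto simp: eventually_at_filter)
  moreover have "((\<lambda>q. \<bar>m q - m p\<bar>) \<longlongrightarrow> 0) (at p within S)"
    using m by (auto intro!: tendsto_eq_intros)
  ultimately have "((\<lambda>q. (g q - g p) / (q - p) - m p) \<longlongrightarrow> 0) (at p within S)"
    by (rule Lim_null_comparison)
  then show ?thesis
    by (simp add: has_field_derivative_iff LIM_zero_iff)
qed

text \<open>Used to glue the two branches of \<open>u\<close>, and then of \<open>u1\<close>, at
  \<open>y\<^sub>0\<close>. The left branch lives on a half-open interval and is differentiable only
  from the left at \<open>a\<close>, while the power branch is smooth across
  \<open>a\<close>.\<close>

lemma has_real_derivative_If_le:
  fixes f g :: "real \<Rightarrow> real"
  assumes f: "\<And>y. 0 < y \<Longrightarrow> y \<le> a \<Longrightarrow> (f has_real_derivative D y) (at y within {0<..a})"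
    and g: "\<And>y. a \<le> y \<Longrightarrow> (g has_real_derivative E y) (at y)"
    and eq: "f a = g a" "D a = E a" and "0 < a" "0 < y"
  shows "((\<lambda>y. if y \<le> a then f y else g y) has_real_derivative (if y \<le> a then D y else E y)) (at y)"
    (is "(?h has_real_derivative _) _")
proof -
  consider "y < a" | "y = a" | "a < y" by linarith
  then show ?thesis
  proof cases
    case 1
    have "at y within {0<..a} = at y"
      using 1 \<open>0 < y\<close> by (intro at_within_interior) simp
    with f[of y] have "(f has_real_derivative D y) (at y)"
      using 1 \<open>0 < y\<close> by simp
    then have "(?h has_real_derivative D y) (at y)"
      by (rule has_field_derivative_transform_within_open[where S = "{..<a}"]) (use 1 in auto)
    with 1 show ?thesis by simp
  next
    case 2
    \<comment> \<open>Both one-sided difference quotients tend to \<open>D a\<close>; the union of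
      the two sides is the open half line, so the restriction on the filter disappears.\<close>
    have "(?h has_real_derivative D a) (at a within {0<..a})"
      by (rule has_field_derivative_transform_within[OF f[of a] zero_less_one])
        (use \<open>0 < a\<close> in auto)
    moreover have "(?h has_real_derivative D a) (at a within {a..})"
      unfolding \<open>D a = E a\<close>
      by (rule has_field_derivative_transform_within
          [OF has_field_derivative_at_within[OF g[of a]] zero_less_one])
        (use eq in auto)
    ultimately have "(?h has_real_derivative D a) (at a within {0<..a} \<union> {a..})"
      unfolding has_field_derivative_iff by (rule Lim_Un)
    moreover have "{0<..a} \<union> {a..} = {0<..}" using \<open>0 < a\<close> by auto
    ultimately show ?thesis using 2 \<open>0 < a\<close> at_within_open[of a "{0<..}"] by simp
  next
    case 3
    have "(?h has_real_derivative E y) (at y)"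
      by (rule has_field_derivative_transform_within_open[OF g, where S = "{a<..}"]) (use 3 in auto)
    with 3 show ?thesis by simp
  qed
qed

section \<open>Convex conjugation\<close>

text \<open>Isolates the properties of \<open>u\<close> on which the passage to \<open>v\<close>
  rests. The two limits make \<open>deriv u\<close> run through all of the negative half line, so
  \<open>deriv_inv u (- x)\<close> is meaningful for every \<open>x > 0\<close>.\<close>

locale convex_dual =
  fixes u :: "real \<Rightarrow> real"
  assumes u': "y > 0 \<Longrightarrow> (u has_real_derivative deriv u y) (at y)"
    and u'': "y > 0 \<Longrightarrow> (deriv u has_real_derivative deriv (deriv u) y) (at y)"
    and u''_pos: "y > 0 \<Longrightarrow> deriv (deriv u) y > 0"
    and u'_at_0: "filterlim (deriv u) at_bot (at_right 0)"
    and u'_at_top: "(deriv u \<longlongrightarrow> 0) at_top"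
begin

lemma deriv_u_less_iff: "0 < a \<Longrightarrow> 0 < b \<Longrightarrow> deriv u a < deriv u b \<longleftrightarrow> a < b"
proof -
  have *: "deriv u a < deriv u b" if "0 < a" "a < b" for a b
  proof (rule DERIV_pos_imp_increasing[OF \<open>a < b\<close>])
    fix y assume "a \<le> y" "y \<le> b"
    with \<open>0 < a\<close> have "0 < y" by simp
    then show "\<exists>D. (deriv u has_real_derivative D) (at y) \<and> 0 < D"
      using u'' u''_pos by blast
  qed
  show "0 < a \<Longrightarrow> 0 < b \<Longrightarrow> ?thesis"
    using *[of a b] *[of b a] by (cases a b rule: linorder_cases) auto
qed

text \<open>An increasing function with limit 0 at infinity is negative. The limit gives only a weak
  bound, so it is applied at \<open>y + 1\<close>, and strict monotonicity does the rest.\<close>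

lemma deriv_u_neg: "0 < y \<Longrightarrow> deriv u y < 0"
proof -
  assume y: "0 < y"
  have "\<forall>\<^sub>F z in at_top. deriv u (y + 1) \<le> deriv u z"
    using eventually_gt_at_top[of "y + 1"]
    by eventually_elim (use y in \<open>simp add: deriv_u_less_iff less_imp_le\<close>)
  then have "deriv u (y + 1) \<le> 0"
    by (intro tendsto_lowerbound[OF u'_at_top]) auto
  with deriv_u_less_iff[of y "y + 1"] y show ?thesis by simp
qed

text \<open>\<open>deriv_inv\<close> is a choice function, so both claims follow once
  \<open>- x\<close> is known to be a value of \<open>deriv u\<close>. The limits at 0 and at
  infinity provide points \<open>a\<close> and \<open>b\<close> on either side of this level, and
  the intermediate value theorem applies between them.\<close>

lemma deriv_inv:
  assumes "0 < x"
  shows deriv_inv_pos: "0 < deriv_inv u (- x)"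
    and deriv_deriv_inv: "deriv u (deriv_inv u (- x)) = - x"
proof -
  have "\<forall>\<^sub>F z in at_right 0. deriv u z < - x"
    using u'_at_0 by (simp add: filterlim_at_bot_dense)
  moreover have "\<forall>\<^sub>F z::real in at_right 0. z > 0"
    by (simp add: eventually_at_right_less)
  ultimately have "\<forall>\<^sub>F z in at_right 0. z > 0 \<and> deriv u z < - x" by eventually_elim auto
  then obtain a where a: "0 < a" "deriv u a < - x"
    using eventually_happens'[OF trivial_limit_at_right_real] by blast
  have "\<forall>\<^sub>F z in at_top. deriv u z > - x"
    using order_tendstoD(1)[OF u'_at_top, of "- x"] assms by simp
  then have "\<forall>\<^sub>F z in at_top. deriv u z > - x \<and> z > a"
    using eventually_gt_at_top by (rule eventually_conj)
  then obtain b where b: "a < b" "deriv u b > - x"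
    using eventually_happens'[OF trivial_limit_at_top_linorder] by blast
  have "\<exists>y\<ge>a. y \<le> b \<and> deriv u y = - x"
  proof (rule IVT)
    show "\<forall>y. a \<le> y \<and> y \<le> b \<longrightarrow> isCont (deriv u) y"
      using a DERIV_isCont[OF u''] by simp
  qed (use a b in auto)
  then obtain y where "0 < y" "deriv u y = - x"
    using a by (meson less_le_trans)
  then have "- x \<in> deriv u ` {0<..}" by (metis greaterThan_iff image_eqI)
  from inv_into_into[OF this] f_inv_into_f[OF this]
  show "0 < deriv_inv u (- x)" "deriv u (deriv_inv u (- x)) = - x"
    by (auto simp: deriv_inv_def)
qed

text \<open>Together with its mirror image this turns a bound on the inverse into a bound on
  \<open>x\<close> by a fixed value of \<open>deriv u\<close>. Limits and continuity of the inverse,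
  and later the comparison with \<open>y\<^sub>0\<close>, are all obtained this way.\<close>

lemma deriv_inv_less_iff:
  "0 < x \<Longrightarrow> 0 < b \<Longrightarrow> deriv_inv u (- x) < b \<longleftrightarrow> - x < deriv u b"
  using deriv_u_less_iff[of "deriv_inv u (- x)" b] by (simp add: deriv_inv_pos deriv_deriv_inv)

lemma less_deriv_inv_iff:
  "0 < x \<Longrightarrow> 0 < b \<Longrightarrow> b < deriv_inv u (- x) \<longleftrightarrow> deriv u b < - x"
  using deriv_u_less_iff[of b "deriv_inv u (- x)"] by (simp add: deriv_inv_pos deriv_deriv_inv)

lemma deriv_inv_at_top: "((\<lambda>x. deriv_inv u (- x)) \<longlongrightarrow> 0) at_top"
proof (rule order_tendstoI)
  fix a :: real assume "a < 0"
  show "\<forall>\<^sub>F x in at_top. a < deriv_inv u (- x)"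
    using eventually_gt_at_top[of 0]
    by eventually_elim (use \<open>a < 0\<close> deriv_inv_pos in force)
next
  fix a :: real assume a: "0 < a"
  show "\<forall>\<^sub>F x in at_top. deriv_inv u (- x) < a"
    using eventually_gt_at_top[of 0] eventually_gt_at_top[of "- deriv u a"]
    by eventually_elim (use a deriv_inv_less_iff in auto)
qed

lemma deriv_inv_at_0: "filterlim (\<lambda>x. deriv_inv u (- x)) at_top (at_right 0)"
  unfolding filterlim_at_top_gt[where c = 0]
proof safe
  fix Z :: real assume Z: "0 < Z"
  have "\<forall>\<^sub>F x in at_right 0. x < - deriv u Z"
    using deriv_u_neg[OF Z] by (intro order_tendstoD(2)[OF tendsto_ident_at]) auto
  moreover have "\<forall>\<^sub>F z::real in at_right 0. z > 0"
    by (simp add: eventually_at_right_less)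
  ultimately show "\<forall>\<^sub>F x in at_right 0. Z \<le> deriv_inv u (- x)"
    by eventually_elim (use Z less_deriv_inv_iff in force)
qed

lemma continuous_deriv_inv:
  assumes "0 < x" shows "isCont (\<lambda>x. deriv_inv u (- x)) x"
  unfolding isCont_def
proof (rule order_tendstoI)
  have pos: "\<forall>\<^sub>F z in at x. 0 < z"
    using assms by (intro order_tendstoD(1)[OF tendsto_ident_at]) auto
  show "\<forall>\<^sub>F z in at x. a < deriv_inv u (- z)" if a: "a < deriv_inv u (- x)" for a
  \<comment> \<open>The equivalences speak only of positive levels; a lower bound
    \<open>a \<le> 0\<close> holds by positivity of the inverse.\<close>
  proof (cases "a > 0")
    case True
    then have "\<forall>\<^sub>F z in at x. z < - deriv u a"
      using assms a less_deriv_inv_iff[of x a]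
      by (intro order_tendstoD(2)[OF tendsto_ident_at]) auto
    with pos show ?thesis
      by eventually_elim (use True less_deriv_inv_iff in force)
  next
    case False
    from pos show ?thesis by eventually_elim (use False deriv_inv_pos in force)
  qed
  show "\<forall>\<^sub>F z in at x. deriv_inv u (- z) < a" if a: "deriv_inv u (- x) < a" for a
  proof -
    from a deriv_inv_pos[OF assms] have "0 < a" by simp
    then have "\<forall>\<^sub>F z in at x. z > - deriv u a"
      using assms a deriv_inv_less_iff[of x a]
      by (intro order_tendstoD(1)[OF tendsto_ident_at]) auto
    with pos show ?thesis
      by eventually_elim (use \<open>0 < a\<close> deriv_inv_less_iff in force)
  qed
qed

lemma deriv_inv_has_derivative:
  assumes "0 < x"
  shows "((\<lambda>x. deriv_inv u (- x)) has_real_derivative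
    - 1 / deriv (deriv u) (deriv_inv u (- x))) (at x)"
proof -
  let ?Y = "\<lambda>x. deriv_inv u (- x)"
  have "(?Y has_real_derivative inverse (- deriv (deriv u) (?Y x))) (at x)"
  \<comment> \<open>\<open>?Y\<close> is the inverse of \<open>- deriv u\<close> on the positive
    half line, so no separate chain rule for the sign is needed. Any interval of positive numbers
    around \<open>x\<close> would serve as \<open>(a, b)\<close>.\<close>
  proof (rule DERIV_inverse_function[where f = "\<lambda>y. - deriv u y" and a = 0 and b = "x + 1"])
    show "((\<lambda>y. - deriv u y) has_real_derivative - deriv (deriv u) (?Y x)) (at (?Y x))"
      using u''[OF deriv_inv_pos[OF assms]] by (rule DERIV_minus)
    show "- deriv (deriv u) (?Y x) \<noteq> 0"
      using u''_pos[OF deriv_inv_pos[OF assms]] by simp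
  qed (use assms deriv_deriv_inv continuous_deriv_inv in auto)
  then show ?thesis by (simp add: inverse_eq_divide)
qed

text \<open>Envelope argument: the derivative \<open>d\<close> of the inverse enters once with
  factor \<open>deriv u (?Y x) = - x\<close> and once with factor \<open>x\<close>, and these terms
  cancel.\<close>

lemma primal_value_has_derivative:
  assumes "0 < x"
  shows "(primal_value u has_real_derivative deriv_inv u (- x)) (at x)"
proof -
  let ?Y = "\<lambda>x. deriv_inv u (- x)"
  define d where "d = - 1 / deriv (deriv u) (?Y x)"
  have Y: "(?Y has_real_derivative d) (at x)"
    unfolding d_def by (rule deriv_inv_has_derivative[OF assms])
  have "((\<lambda>x. u (?Y x)) has_real_derivative deriv u (?Y x) * d) (at x)"
    by (rule DERIV_chain2[OF u' Y]) (rule deriv_inv_pos[OF assms])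
  moreover have "((\<lambda>x. x * ?Y x) has_real_derivative 1 * ?Y x + d * x) (at x)"
    by (rule DERIV_mult[OF DERIV_ident Y])
  ultimately have "((\<lambda>x. u (?Y x) + x * ?Y x) has_real_derivative
      deriv u (?Y x) * d + (1 * ?Y x + d * x)) (at x)"
    by (rule DERIV_add)
  then show ?thesis
    unfolding primal_value_def[abs_def] deriv_deriv_inv[OF assms] by (simp add: mult.commute)
qed

lemma deriv_primal_value: "0 < x \<Longrightarrow> deriv (primal_value u) x = deriv_inv u (- x)"
  by (rule DERIV_imp_deriv[OF primal_value_has_derivative])

lemma deriv_primal_value_has_derivative:
  assumes "0 < x"
  shows "(deriv (primal_value u) has_real_derivative
    - 1 / deriv (deriv u) (deriv (primal_value u) x)) (at x)"
  unfolding deriv_primal_value[OF assms]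
  by (rule has_field_derivative_transform_within_open
      [OF deriv_inv_has_derivative[OF assms], where S = "{0<..}"])
    (use assms in \<open>auto simp: deriv_primal_value\<close>)

lemma deriv_primal_value_at_top: "(deriv (primal_value u) \<longlongrightarrow> 0) at_top"
  using deriv_inv_at_top
proof (rule Lim_transform_eventually)
  show "\<forall>\<^sub>F x in at_top. deriv_inv u (- x) = deriv (primal_value u) x"
    using eventually_gt_at_top[of 0] by eventually_elim (simp add: deriv_primal_value)
qed

lemma deriv_primal_value_at_0: "filterlim (deriv (primal_value u)) at_top (at_right 0)"
proof -
  have "\<forall>\<^sub>F x in at_right 0. deriv (primal_value u) x = deriv_inv u (- x)"
    by (auto simp: eventually_at_filter deriv_primal_value)
  then show ?thesis
    using deriv_inv_at_0 by (simp cong: filterlim_cong)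
qed

end

section \<open>Utility functions\<close>

locale utility_fun =
  fixes f :: "real \<Rightarrow> real"
  assumes utility: "utility f"
begin

lemma has_derivative: "0 < x \<Longrightarrow> (f has_real_derivative deriv f x) (at x)"
  using utility by (simp add: utility_def C2_on_def DERIV_deriv_iff_real_differentiable)

lemma deriv_has_derivative: "0 < x \<Longrightarrow> (deriv f has_real_derivative deriv (deriv f) x) (at x)"
  using utility by (simp add: utility_def C2_on_def DERIV_deriv_iff_real_differentiable)

text \<open>Prepares the mean value theorem on intervals that start at 0. There only the right limit
  of \<open>f\<close> is known, hence continuity relative to the interval.\<close>

lemma continuous_on_nonneg: "continuous_on {0..b} f"
  unfolding continuous_on_eq_continuous_within
proof
  fix x assume "x \<in> {0..b}"
  then consider "x = 0" | "0 < x" by fastforce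
  then show "continuous (at x within {0..b}) f"
  proof cases
    case 1
    have "(f \<longlongrightarrow> f 0) (at 0 within {0<..})"
      using utility by (simp add: utility_def)
    then have "(f \<longlongrightarrow> f 0) (at 0 within insert 0 {0<..})"
      by (simp add: at_within_def)
    then show ?thesis unfolding continuous_within 1
      by (rule tendsto_within_subset) auto
  next
    case 2
    then show ?thesis
      by (rule continuous_at_imp_continuous_within[OF DERIV_isCont[OF has_derivative]])
  qed
qed

lemma deriv_strict_antimono:
  assumes "0 < a" "a < b" shows "deriv f b < deriv f a"
proof (rule DERIV_neg_imp_decreasing[OF \<open>a < b\<close>])
  fix x assume "a \<le> x"
  with \<open>0 < a\<close> have "0 < x" by simp
  moreover have "deriv (deriv f) x < 0"
    using utility \<open>0 < x\<close> by (simp add: utility_def)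
  ultimately show "\<exists>D. (deriv f has_real_derivative D) (at x) \<and> D < 0"
    using deriv_has_derivative by blast
qed

text \<open>\<open>marginal f 0\<close> is given by \<open>Lim\<close>, which says nothing until
  convergence is shown. As \<open>deriv f\<close> is decreasing, it converges at 0 to its supremum,
  in the extended reals.\<close>

lemma marginal_at_0: "((\<lambda>t. ereal (deriv f t)) \<longlongrightarrow> marginal f 0) (at_right 0)"
proof -
  let ?M = "SUP t\<in>{0<..}. ereal (deriv f t)"
  have pos: "\<forall>\<^sub>F t::real in at_right 0. 0 < t"
    by (simp add: eventually_at_right_less)
  have lim: "((\<lambda>t. ereal (deriv f t)) \<longlongrightarrow> ?M) (at_right 0)"
  proof (rule increasing_tendsto)
    show "\<forall>\<^sub>F t in at_right 0. ereal (deriv f t) \<le> ?M"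
      using pos by eventually_elim (auto intro: SUP_upper)
    fix e assume "e < ?M"
    then obtain t where t: "0 < t" "e < ereal (deriv f t)"
      by (auto simp: less_SUP_iff)
    have "\<forall>\<^sub>F s in at_right 0. s < t"
      using t by (intro order_tendstoD(2)[OF tendsto_ident_at]) auto
    with pos show "\<forall>\<^sub>F s in at_right 0. e < ereal (deriv f s)"
    proof eventually_elim
      case (elim s)
      from deriv_strict_antimono[OF this] t(2) show ?case
        by (metis less_ereal.simps(1) less_trans)
    qed
  qed
  then have "marginal f 0 = ?M"
    by (simp add: marginal_def tendsto_Lim)
  with lim show ?thesis by simp
qed

lemma marginal_pos_arg: "0 < x \<Longrightarrow> marginal f x = ereal (deriv f x)"
  by (simp add: marginal_def)

lemma marginal_strict_antimono:
  assumes "0 \<le> a" "a < b" shows "marginal f b < marginal f a"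
proof (cases "a = 0")
  case True
  \<comment> \<open>Passing to the limit keeps only weak inequalities. The comparison is therefore
    made at \<open>b / 2\<close>, and strictness comes from \<open>b / 2 < b\<close>.\<close>
  have "\<forall>\<^sub>F s in at_right 0. s < b / 2"
    using assms by (intro order_tendstoD(2)[OF tendsto_ident_at]) auto
  moreover have "\<forall>\<^sub>F t::real in at_right 0. 0 < t"
    by (simp add: eventually_at_right_less)
  ultimately have "\<forall>\<^sub>F s in at_right 0. ereal (deriv f (b / 2)) \<le> ereal (deriv f s)"
  proof eventually_elim
    case (elim s)
    then show ?case using deriv_strict_antimono[of s "b / 2"] by simp
  qed
  then have "ereal (deriv f (b / 2)) \<le> marginal f 0"
    by (intro tendsto_lowerbound[OF marginal_at_0]) auto
  moreover have "ereal (deriv f b) < ereal (deriv f (b / 2))"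
    using assms deriv_strict_antimono[of "b / 2" b] by simp
  ultimately have "ereal (deriv f b) < marginal f 0"
    using less_le_trans by blast
  then show ?thesis
    using True assms by (simp add: marginal_pos_arg)
next
  case False
  with assms show ?thesis
    using deriv_strict_antimono[of a b] by (simp add: marginal_pos_arg)
qed

lemma marginal_less_iff: "0 \<le> a \<Longrightarrow> 0 \<le> b \<Longrightarrow> marginal f a < marginal f b \<longleftrightarrow> b < a"
  using marginal_strict_antimono[of a b] marginal_strict_antimono[of b a]
  by (cases a b rule: linorder_cases) auto

lemma marginal_inv_eq:
  assumes "0 \<le> x" "marginal f x = ereal p" shows "marginal_inv f p = x"
proof -
  have "inj_on (marginal f) {0..}"
    by (rule linorder_inj_onI') (use marginal_strict_antimono in force)
  then show ?thesis
    unfolding marginal_inv_def assms(2)[symmetric]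
    by (rule inv_into_f_f) (use assms in simp)
qed

text \<open>A concave function lies below its tangents. The point of tangency may be
  \<open>z = 0\<close> if the limit of \<open>deriv f\<close> there is finite: the mean value slope
  is compared with \<open>p\<close> through \<open>marginal\<close>, which is strictly decreasing up
  to and including 0.\<close>

lemma tangent_above:
  assumes "0 \<le> x" "0 \<le> z" "marginal f z = ereal p"
  shows "f x \<le> f z + p * (x - z)"
proof -
  have mvt: "\<exists>\<xi>. a < \<xi> \<and> \<xi> < b \<and> f b - f a = (b - a) * deriv f \<xi>" if "0 \<le> a" "a < b" for a b
  proof -
    have "continuous_on {a..b} f"
      by (rule continuous_on_subset[OF continuous_on_nonneg[of b]]) (use that in auto)
    moreover have "f differentiable (at y)" if "a < y" for y
      using has_derivative[of y] \<open>0 \<le> a\<close> that real_differentiable_def by auto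
    ultimately obtain D \<xi>
      where "a < \<xi>" "\<xi> < b" "(f has_real_derivative D) (at \<xi>)" "f b - f a = (b - a) * D"
      using MVT[OF \<open>a < b\<close>, of f] by blast
    moreover from this have "deriv f \<xi> = D" by (simp add: DERIV_imp_deriv)
    ultimately show ?thesis by blast
  qed
  consider "x = z" | "x < z" | "z < x" by linarith
  then show ?thesis
  proof cases
    case 2
    then obtain \<xi> where \<xi>: "x < \<xi>" "\<xi> < z" "f z - f x = (z - x) * deriv f \<xi>"
      using mvt assms by blast
    then have "p < deriv f \<xi>"
      using marginal_strict_antimono[of \<xi> z] assms by (simp add: marginal_pos_arg)
    then have "p * (z - x) \<le> deriv f \<xi> * (z - x)"
      using 2 by (intro mult_right_mono) auto
    with \<xi>(3) show ?thesis by (simp add: algebra_simps)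
  next
    case 3
    then obtain \<xi> where \<xi>: "z < \<xi>" "\<xi> < x" "f x - f z = (x - z) * deriv f \<xi>"
      using mvt assms by blast
    then have "deriv f \<xi> < p"
      using marginal_strict_antimono[of z \<xi>] assms by (simp add: marginal_pos_arg)
    then have "deriv f \<xi> * (x - z) \<le> p * (x - z)"
      using 3 by (intro mult_right_mono) auto
    with \<xi>(3) show ?thesis by (simp add: algebra_simps)
  qed simp
qed

text \<open>The interval on which \<open>marginal_inv f\<close> is a genuine inverse. It contains
  its right endpoint if \<open>marginal f 0\<close> is finite and is unbounded otherwise.\<close>

definition marginals :: "real set" where
  "marginals = {p. 0 < p \<and> ereal p \<le> marginal f 0}"

text \<open>The endpoint \<open>marginal f 0\<close> is attained at 0. Below it,
  \<open>deriv f\<close> exceeds \<open>p\<close> near 0 and falls under \<open>p\<close> far out,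
  so the intermediate value theorem gives a positive preimage.\<close>

lemma marginal_surj:
  assumes "p \<in> marginals" shows "\<exists>x\<ge>0. marginal f x = ereal p"
proof (cases "marginal f 0 = ereal p")
  case False
  then have "ereal p < marginal f 0" using assms by (simp add: marginals_def order.not_eq_order_implies_strict)
  then have "\<forall>\<^sub>F t in at_right 0. p < deriv f t"
    using order_tendstoD(1)[OF marginal_at_0, of "ereal p"] by simp
  moreover have "\<forall>\<^sub>F t::real in at_right 0. 0 < t"
    by (simp add: eventually_at_right_less)
  ultimately have "\<forall>\<^sub>F t in at_right 0. p < deriv f t \<and> 0 < t"
    by (rule eventually_conj)
  then obtain a where a: "0 < a" "p < deriv f a"
    using eventually_happens'[OF trivial_limit_at_right_real] by blast
  have "(deriv f \<longlongrightarrow> 0) at_top"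
    using utility by (simp add: utility_def)
  then have "\<forall>\<^sub>F t in at_top. deriv f t < p"
    using assms by (intro order_tendstoD(2)) (auto simp: marginals_def)
  then have "\<forall>\<^sub>F t in at_top. deriv f t < p \<and> a < t"
    using eventually_gt_at_top by (rule eventually_conj)
  then obtain b where b: "a < b" "deriv f b < p"
    using eventually_happens'[OF trivial_limit_at_top_linorder] by blast
  have "\<exists>x\<ge>a. x \<le> b \<and> deriv f x = p"
  proof (rule IVT2)
    show "\<forall>x. a \<le> x \<and> x \<le> b \<longrightarrow> isCont (deriv f) x"
      using a DERIV_isCont[OF deriv_has_derivative] by simp
  qed (use a b in auto)
  then obtain x where "a \<le> x" "deriv f x = p" by blast
  then show ?thesis
    using a by (intro exI[of _ x]) (simp add: marginal_pos_arg)
qed (use assms in auto)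

lemma marginal_inv:
  assumes "p \<in> marginals"
  shows marginal_inv_nonneg: "0 \<le> marginal_inv f p"
    and marginal_marginal_inv: "marginal f (marginal_inv f p) = ereal p"
  using marginal_surj[OF assms] marginal_inv_eq by auto

text \<open>Strict monotonicity translates bounds on the inverse into bounds on its argument, which
  are open conditions in the extended reals. Continuity is relative to \<open>marginals\<close>,
  being one-sided at a finite endpoint.\<close>

lemma continuous_marginal_inv:
  assumes p: "p \<in> marginals" shows "continuous (at p within marginals) (marginal_inv f)"
  unfolding continuous_within
proof (rule order_tendstoI)
  note I = marginal_inv_nonneg marginal_marginal_inv
  have marginals: "\<forall>\<^sub>F q in at p within marginals. q \<in> marginals"
    by (simp add: eventually_at_filter)
  have id: "((\<lambda>q. ereal q) \<longlongrightarrow> ereal p) (at p within marginals)"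
    by (simp add: tendsto_ident_at)
  show "\<forall>\<^sub>F q in at p within marginals. a < marginal_inv f q" if a: "a < marginal_inv f p" for a
  proof (cases "0 \<le> a")
    case True
    then have "ereal p < marginal f a"
      using a marginal_less_iff[of "marginal_inv f p" a] I[OF p] by simp
    then have "\<forall>\<^sub>F q in at p within marginals. ereal q < marginal f a"
      by (rule order_tendstoD(2)[OF id])
    with marginals show ?thesis
    proof eventually_elim
      case (elim q)
      then show ?case using True marginal_less_iff[of "marginal_inv f q" a] I[of q] by simp
    qed
  next
    case False
    from marginals show ?thesis
      by eventually_elim (use False I(1) in force)
  qed
  show "\<forall>\<^sub>F q in at p within marginals. marginal_inv f q < a" if a: "marginal_inv f p < a" for a
  proof -
    have "0 < a" using a I(1)[OF p] by simp
    then have "marginal f a < ereal p"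
      using a marginal_less_iff[of a "marginal_inv f p"] I[OF p] by simp
    then have "\<forall>\<^sub>F q in at p within marginals. marginal f a < ereal q"
      by (rule order_tendstoD(1)[OF id])
    with marginals show ?thesis
    proof eventually_elim
      case (elim q)
      then show ?case
        using \<open>0 < a\<close> marginal_less_iff[of a "marginal_inv f q"] I[of q] by simp
    qed
  qed
qed

text \<open>
  \<open>G\<close> is the conjugate \<open>p \<mapsto> max\<^bsub>x\<ge>0\<^esub> (f x - p (\<alpha> + x))\<close>, so its derivative comes from the envelope
  theorem. This covers the endpoint \<open>p = f'(0+)\<close>, where the maximiser \<open>x = 0\<close> is not interior.
\<close>

lemma G_has_derivative:
  assumes "p \<in> marginals"
  shows "(G \<alpha> f has_real_derivative - (\<alpha> + marginal_inv f p)) (at p within marginals)"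
proof (rule subgradient_has_derivative[OF _ _ assms])
  fix p q assume "p \<in> marginals" "q \<in> marginals"
  then show "G \<alpha> f p + (q - p) * - (\<alpha> + marginal_inv f p) \<le> G \<alpha> f q"
    using tangent_above[of "marginal_inv f p" "marginal_inv f q" q] marginal_inv
    by (simp add: G_def algebra_simps)
next
  show "continuous (at p within marginals) (\<lambda>p. - (\<alpha> + marginal_inv f p))"
    by (intro continuous_intros continuous_marginal_inv assms)
qed

end

section \<open>The dual value function\<close>

text \<open>\<nu> is an exponent for which \<open>y powr \<nu>\<close> solves the linear homogeneous
  equation beyond \<open>y\<^sub>0\<close>. With \<open>b\<close> and \<kappa> as below, the
  quadratic is \<open>\<kappa> * \<nu>\<^sup>2 - b * \<nu> - \<delta> = 0\<close>; the product of
  its roots is negative, and \<open>lam\<close> is the smaller one.\<close>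

lemma lam_neg_root:
  fixes r \<mu> \<sigma> \<rho> \<delta> :: real
  assumes "\<mu> > 0" "\<sigma> > 0" "\<delta> > 0"
  defines "\<nu> \<equiv> lam r \<mu> \<sigma> \<rho> \<delta>"
  shows lam_neg: "\<nu> < 0"
    and lam_root: "\<mu>\<^sup>2 / (2 * \<sigma>\<^sup>2) * \<nu> * (\<nu> - 1) = (r + \<rho> - \<delta>) * \<nu> + \<delta>"
proof -
  define \<kappa> where "\<kappa> = \<mu>\<^sup>2 / (2 * \<sigma>\<^sup>2)"
  define b where "b = \<kappa> + r + \<rho> - \<delta>"
  define s where "s = sqrt (b\<^sup>2 + 4 * \<delta> * \<kappa>)"
  have \<kappa>: "\<kappa> > 0" using assms by (simp add: \<kappa>_def)
  have "\<sigma>\<^sup>2 / \<mu>\<^sup>2 = 1 / (2 * \<kappa>)" "\<mu>\<^sup>2 / \<sigma>\<^sup>2 = 2 * \<kappa>"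
    using assms by (simp_all add: \<kappa>_def)
  then have \<nu>: "\<nu> = (b - s) / (2 * \<kappa>)"
    by (simp add: \<nu>_def lam_def s_def b_def flip: \<kappa>_def)
  have "\<bar>b\<bar> < s"
    unfolding s_def using \<kappa> \<open>\<delta> > 0\<close> by (intro real_less_rsqrt) simp
  then show "\<nu> < 0" using \<kappa> by (simp add: \<nu> divide_neg_pos)
  have "s\<^sup>2 = b\<^sup>2 + 4 * \<delta> * \<kappa>"
    unfolding s_def using \<kappa> \<open>\<delta> > 0\<close> by simp
  moreover have s: "s = b - 2 * \<kappa> * \<nu>" using \<kappa> by (simp add: \<nu>)
  ultimately have "4 * \<kappa> * (\<kappa> * \<nu>\<^sup>2 - b * \<nu> - \<delta>) = 0"
    by (simp add: power2_eq_square algebra_simps)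
  then have "\<kappa> * \<nu>\<^sup>2 - b * \<nu> - \<delta> = 0"
    using \<kappa> by simp
  then have "\<kappa> * \<nu> * (\<nu> - 1) = (r + \<rho> - \<delta>) * \<nu> + \<delta>"
    by (simp add: b_def power2_eq_square algebra_simps)
  then show "\<mu>\<^sup>2 / (2 * \<sigma>\<^sup>2) * \<nu> * (\<nu> - 1) = (r + \<rho> - \<delta>) * \<nu> + \<delta>"
    by (simp add: \<kappa>_def)
qed

locale dual_problem = utility_fun Up for Up :: "real \<Rightarrow> real" +
  fixes r \<mu> \<sigma> \<rho> \<delta> \<alpha> c\<^sub>0 \<phi>\<^sub>0 y\<^sub>0 :: real and Um \<phi> \<psi> :: "real \<Rightarrow> real"
  assumes pos: "\<mu> > 0" "\<sigma> > 0" "\<rho> > 0" "\<delta> > 0"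
    and c\<^sub>0: "c\<^sub>0 \<ge> \<alpha>" "\<alpha> > 0"
      "ereal c\<^sub>0 * marginal Up (c\<^sub>0 - \<alpha>) - ereal (Up (c\<^sub>0 - \<alpha>)) = ereal (Um \<alpha>)"
    and \<phi>\<^sub>0: "ereal \<phi>\<^sub>0 = marginal Up (c\<^sub>0 - \<alpha>)"
    and triple: "dual_triple r \<mu> \<sigma> \<rho> \<delta> \<alpha> Up \<phi>\<^sub>0 y\<^sub>0 \<phi> \<psi>"
begin

definition "\<kappa> = \<mu>\<^sup>2 / (2 * \<sigma>\<^sup>2)"
definition "\<nu> = lam r \<mu> \<sigma> \<rho> \<delta>"

abbreviation "U0 \<equiv> S_utility \<alpha> Up Um 0"
abbreviation "I \<equiv> marginal_inv Up"
abbreviation "u \<equiv> dual_value r \<mu> \<sigma> \<rho> \<delta> \<alpha> Up Um \<phi>\<^sub>0 y\<^sub>0 \<phi> \<psi>"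

definition "u_left y = 1 / \<delta> * (\<kappa> / \<rho> * (\<phi> y * \<psi> y) + G \<alpha> Up (\<phi> y) + (\<delta> - r - \<rho>) / \<rho> * (y - \<phi> y))"
definition "u_right y = (y\<^sub>0 - \<phi>\<^sub>0) / (\<rho> * \<nu>) * (y / y\<^sub>0) powr \<nu> + U0 / \<delta>"

text \<open>Closed forms that will turn out to be the first two derivatives of \<open>u\<close> on
  the positive half line.\<close>

definition "u1 y = (if y \<le> y\<^sub>0 then (y - \<phi> y) / (\<rho> * y)
  else (y\<^sub>0 - \<phi>\<^sub>0) / (\<rho> * y\<^sub>0) * (y / y\<^sub>0) powr (\<nu> - 1))"
definition "u2 y = (if y \<le> y\<^sub>0 then \<phi> y * \<psi> y / (\<rho> * y\<^sup>2)
  else (y\<^sub>0 - \<phi>\<^sub>0) * (\<nu> - 1) / (\<rho> * y\<^sub>0\<^sup>2) * (y / y\<^sub>0) powr (\<nu> - 2))"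

lemma u_eq: "u = (\<lambda>y. if y \<le> y\<^sub>0 then u_left y else u_right y)"
  by (simp add: fun_eq_iff dual_value_def u_left_def u_right_def \<nu>_def \<kappa>_def ac_simps)

lemma \<kappa>_pos: "\<kappa> > 0"
  using pos by (simp add: \<kappa>_def)

lemma \<nu>_neg: "\<nu> < 0"
  unfolding \<nu>_def using pos by (intro lam_neg)

lemma \<nu>_root: "\<kappa> * \<nu> * (\<nu> - 1) = (r + \<rho> - \<delta>) * \<nu> + \<delta>"
  unfolding \<nu>_def \<kappa>_def using pos by (intro lam_root)

lemma y\<^sub>0: shows y\<^sub>0_less: "y\<^sub>0 < \<phi>\<^sub>0" and y\<^sub>0_gt: "\<phi>\<^sub>0 * \<nu> / (\<nu> - 1) < y\<^sub>0"
  using triple by (simp_all add: dual_triple_def \<nu>_def)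

text \<open>Read off from the interval for \<open>y\<^sub>0\<close>: the factor
  \<open>\<nu> / (\<nu> - 1)\<close> is below 1, so the interval could not have its endpoints in
  this order if \<open>\<phi>\<^sub>0\<close> were not positive.\<close>

lemma \<phi>\<^sub>0_pos: "0 < \<phi>\<^sub>0"
proof -
  have "\<phi>\<^sub>0 * (\<nu> / (\<nu> - 1)) < \<phi>\<^sub>0 * 1" using y\<^sub>0 by simp
  moreover have "\<nu> / (\<nu> - 1) < 1" using \<nu>_neg by (simp add: divide_less_eq)
  ultimately show ?thesis
    by (metis mult_left_mono_neg less_le_not_le not_le)
qed

lemma y\<^sub>0_pos: "0 < y\<^sub>0"
proof -
  have "0 < \<phi>\<^sub>0 * \<nu> / (\<nu> - 1)"
    using \<phi>\<^sub>0_pos \<nu>_neg by (simp add: divide_neg_neg mult_pos_neg)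
  then show ?thesis using y\<^sub>0_gt by linarith
qed

text \<open>In this form the lower bound on \<open>y\<^sub>0\<close> says that \<open>y +
  (\<phi>\<^sub>0 - y\<^sub>0) * (y / y\<^sub>0) powr \<nu>\<close> has positive slope at
  \<open>y\<^sub>0\<close>.\<close>

lemma y\<^sub>0_lower: "- \<nu> * (\<phi>\<^sub>0 - y\<^sub>0) < y\<^sub>0"
  using y\<^sub>0_gt \<nu>_neg by (simp add: neg_divide_less_eq algebra_simps)

lemma \<phi>\<psi>_bounds:
  assumes "0 < y" "y \<le> y\<^sub>0"
  shows \<phi>_pos: "0 < \<phi> y" and \<phi>_le: "\<phi> y \<le> \<phi>\<^sub>0" and \<psi>_pos: "0 < \<psi> y" and \<psi>_less: "\<psi> y < 1"
  using triple assms by (auto simp: dual_triple_def image_subset_iff)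

lemma \<phi>_has_derivative:
  "0 < y \<Longrightarrow> y \<le> y\<^sub>0 \<Longrightarrow>
    (\<phi> has_real_derivative \<phi> y * (1 - \<psi> y) / y) (at y within {0<..y\<^sub>0})"
  using triple by (simp add: dual_triple_def)

lemma \<psi>_has_derivative:
  assumes "0 < y" "y \<le> y\<^sub>0"
  shows "(\<psi> has_real_derivative - (\<rho> / \<kappa>) *
      ((1 - \<psi> y) / y * (\<kappa> / \<rho> * \<psi> y - I (\<phi> y) + (r - \<delta>) / \<rho> + 1 - \<alpha>)
        - (r + \<rho>) / (\<rho> * \<phi> y) + \<delta> / (\<rho> * y))) (at y within {0<..y\<^sub>0})"
proof -
  have "2 * \<rho> * \<sigma>\<^sup>2 / \<mu>\<^sup>2 = \<rho> / \<kappa>" "\<mu>\<^sup>2 / (2 * \<rho> * \<sigma>\<^sup>2) = \<kappa> / \<rho>"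
    using pos by (simp_all add: \<kappa>_def)
  then show ?thesis
    using triple assms by (simp add: dual_triple_def)
qed

lemma \<phi>_y\<^sub>0: "\<phi> y\<^sub>0 = \<phi>\<^sub>0"
  using triple by (simp add: dual_triple_def)

text \<open>Dividing the quadratic for \<nu> by \<nu> replaces the bracket in the prescribed value
  of \<psi> by \<open>\<kappa> * (\<nu> - 1)\<close>. The result is the equality of the two branches
  of \<open>u2\<close> at \<open>y\<^sub>0\<close>.\<close>

lemma \<psi>_y\<^sub>0: "\<phi>\<^sub>0 * \<psi> y\<^sub>0 = (\<nu> - 1) * (y\<^sub>0 - \<phi>\<^sub>0)"
proof -
  have "\<kappa> * (\<phi>\<^sub>0 * \<psi> y\<^sub>0) = (\<delta> / \<nu> + r + \<rho> - \<delta>) * (y\<^sub>0 - \<phi>\<^sub>0)"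
    using triple pos \<phi>\<^sub>0_pos by (simp add: dual_triple_def \<kappa>_def \<nu>_def)
  moreover have "\<delta> / \<nu> + r + \<rho> - \<delta> = \<kappa> * (\<nu> - 1)"
    using \<nu>_neg \<nu>_root by (simp add: field_simps)
  ultimately show ?thesis using \<kappa>_pos by simp
qed

lemma \<phi>_in_marginals: "0 < y \<Longrightarrow> y \<le> y\<^sub>0 \<Longrightarrow> \<phi> y \<in> marginals"
proof -
  assume y: "0 < y" "y \<le> y\<^sub>0"
  have "ereal (\<phi> y) \<le> ereal \<phi>\<^sub>0" using \<phi>_le[OF y] by simp
  also have "\<dots> \<le> marginal Up 0"
    unfolding \<phi>\<^sub>0 using marginal_strict_antimono[of 0 "c\<^sub>0 - \<alpha>"] c\<^sub>0(1)
    by (cases "c\<^sub>0 = \<alpha>") auto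
  finally show ?thesis
    using \<phi>_pos[OF y] by (simp add: marginals_def)
qed

text \<open>The equation for \<open>c\<^sub>0\<close> is a tangency condition: the tangent to the
  concave branch of the utility at \<open>c\<^sub>0\<close> meets the vertical axis at the utility
  of zero consumption. Its intercept is \<open>G\<close> at \<open>\<phi>\<^sub>0\<close>.\<close>

lemma G_\<phi>\<^sub>0: "G \<alpha> Up \<phi>\<^sub>0 = U0"
proof -
  have "I \<phi>\<^sub>0 = c\<^sub>0 - \<alpha>"
    using \<phi>\<^sub>0 c\<^sub>0(1) by (intro marginal_inv_eq) auto
  then have "G \<alpha> Up \<phi>\<^sub>0 = Up (c\<^sub>0 - \<alpha>) - c\<^sub>0 * \<phi>\<^sub>0"
    by (simp add: G_def mult.commute)
  moreover have "c\<^sub>0 * \<phi>\<^sub>0 - Up (c\<^sub>0 - \<alpha>) = Um \<alpha>"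
    using c\<^sub>0(3) unfolding \<phi>\<^sub>0[symmetric] by simp
  ultimately show ?thesis
    using c\<^sub>0(2) by (simp add: S_utility_def)
qed

section \<open>First and second derivatives of the dual value function\<close>

lemma u_left_has_derivative:
  assumes y: "0 < y" "y \<le> y\<^sub>0"
  shows "(u_left has_real_derivative (y - \<phi> y) / (\<rho> * y)) (at y within {0<..y\<^sub>0})"
proof -
  define d where "d = \<phi> y * (1 - \<psi> y) / y"
  define e where "e = - (\<rho> / \<kappa>) *
      ((1 - \<psi> y) / y * (\<kappa> / \<rho> * \<psi> y - I (\<phi> y) + (r - \<delta>) / \<rho> + 1 - \<alpha>)
        - (r + \<rho>) / (\<rho> * \<phi> y) + \<delta> / (\<rho> * y))"
  have d: "(\<phi> has_real_derivative d) (at y within {0<..y\<^sub>0})"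
    unfolding d_def by (rule \<phi>_has_derivative[OF y])
  have e: "(\<psi> has_real_derivative e) (at y within {0<..y\<^sub>0})"
    unfolding e_def by (rule \<psi>_has_derivative[OF y])
  \<comment> \<open>The chain rule is taken relative to the image of \<phi>, because
    \<open>\<phi>\<^sub>0\<close> may be the endpoint of \<open>marginals\<close>, where
    \<open>G\<close> has only a one-sided derivative.\<close>
  have "(G \<alpha> Up has_real_derivative - (\<alpha> + I (\<phi> y))) (at (\<phi> y) within \<phi> ` {0<..y\<^sub>0})"
    by (rule DERIV_subset[OF G_has_derivative]) (use \<phi>_in_marginals y in auto)
  from DERIV_image_chain[OF this d]
  have g: "((\<lambda>y. G \<alpha> Up (\<phi> y)) has_real_derivative - (\<alpha> + I (\<phi> y)) * d) (at y within {0<..y\<^sub>0})"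
    by (simp add: o_def)
  have "(u_left has_real_derivative 1 / \<delta> * (\<kappa> / \<rho> * (d * \<psi> y + e * \<phi> y)
      + - (\<alpha> + I (\<phi> y)) * d + (\<delta> - r - \<rho>) / \<rho> * (1 - d))) (at y within {0<..y\<^sub>0})"
    unfolding u_left_def[abs_def]
    by (intro DERIV_cmult DERIV_add DERIV_mult DERIV_diff DERIV_ident d e g)
  moreover have "1 / \<delta> * (\<kappa> / \<rho> * (d * \<psi> y + e * \<phi> y)
      + - (\<alpha> + I (\<phi> y)) * d + (\<delta> - r - \<rho>) / \<rho> * (1 - d)) = (y - \<phi> y) / (\<rho> * y)"
  proof -
    \<comment> \<open>Multiplication by \<open>\<kappa> / \<rho> * \<phi> y\<close> clears the
      prefactor of the equation for \<psi> and makes \<open>d\<close> appear. In the total the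
      coefficient of \<open>d\<close> then vanishes, including the terms in \<alpha> and
      \<open>I\<close>.\<close>
    have "\<kappa> / \<rho> * (e * \<phi> y) = - (d * (\<kappa> / \<rho> * \<psi> y - I (\<phi> y) + (r - \<delta>) / \<rho> + 1 - \<alpha>)
        - (r + \<rho>) / \<rho> + \<delta> * \<phi> y / (\<rho> * y))"
      using \<kappa>_pos pos y \<phi>_pos[OF y] by (simp add: e_def d_def field_simps)
    then have "\<kappa> / \<rho> * (d * \<psi> y + e * \<phi> y)
      + - (\<alpha> + I (\<phi> y)) * d + (\<delta> - r - \<rho>) / \<rho> * (1 - d) = \<delta> / \<rho> - \<delta> * \<phi> y / (\<rho> * y)"
      using pos by (simp add: field_simps)
    then show ?thesis using pos y by (simp add: field_simps)
  qed
  ultimately show ?thesis by simp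
qed

lemma powr_has_derivative:
  assumes "0 < y"
  shows "((\<lambda>y. (y / y\<^sub>0) powr a) has_real_derivative a / y\<^sub>0 * (y / y\<^sub>0) powr (a - 1)) (at y)"
proof -
  have "((\<lambda>y. y / y\<^sub>0) has_real_derivative 1 / y\<^sub>0) (at y)"
    by (rule DERIV_cdivide) (rule DERIV_ident)
  from DERIV_chain2[OF has_real_derivative_powr this] show ?thesis
    using assms y\<^sub>0_pos by (simp add: mult.commute)
qed

lemma u_has_derivative:
  assumes "0 < y" shows "(u has_real_derivative u1 y) (at y)"
  unfolding u_eq u1_def
proof (rule has_real_derivative_If_le[OF u_left_has_derivative])
  fix y assume "y\<^sub>0 \<le> y"
  then have "0 < y" using y\<^sub>0_pos by simp
  from DERIV_add[OF DERIV_cmult[OF powr_has_derivative[OF this, of \<nu>],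
      of "(y\<^sub>0 - \<phi>\<^sub>0) / (\<rho> * \<nu>)"] DERIV_const[of "U0 / \<delta>"]]
  show "(u_right has_real_derivative (y\<^sub>0 - \<phi>\<^sub>0) / (\<rho> * y\<^sub>0) * (y / y\<^sub>0) powr (\<nu> - 1)) (at y)"
    using \<nu>_neg by (simp add: u_right_def[abs_def])
next
  \<comment> \<open>Equality of the two branches of \<open>u\<close> at \<open>y\<^sub>0\<close>,
    multiplied by \<open>\<delta> * \<rho>\<close> and without the common term
    \<open>U0\<close>.\<close>
  have "\<kappa> * (\<phi>\<^sub>0 * \<psi> y\<^sub>0) + (\<delta> - r - \<rho>) * (y\<^sub>0 - \<phi>\<^sub>0) = \<delta> / \<nu> * (y\<^sub>0 - \<phi>\<^sub>0)"
  proof -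
    have "\<kappa> * (\<nu> - 1) + (\<delta> - r - \<rho>) = \<delta> / \<nu>"
      using \<nu>_root \<nu>_neg by (simp add: field_simps)
    moreover have "\<kappa> * ((\<nu> - 1) * (y\<^sub>0 - \<phi>\<^sub>0)) + (\<delta> - r - \<rho>) * (y\<^sub>0 - \<phi>\<^sub>0)
        = (\<kappa> * (\<nu> - 1) + (\<delta> - r - \<rho>)) * (y\<^sub>0 - \<phi>\<^sub>0)"
      by (simp only: distrib_right mult.assoc)
    ultimately show ?thesis unfolding \<psi>_y\<^sub>0 by simp
  qed
  then have "\<kappa> / \<rho> * (\<phi>\<^sub>0 * \<psi> y\<^sub>0) + (\<delta> - r - \<rho>) / \<rho> * (y\<^sub>0 - \<phi>\<^sub>0) = \<delta> / \<nu> * (y\<^sub>0 - \<phi>\<^sub>0) / \<rho>"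
    by (metis add_divide_distrib times_divide_eq_left)
  then have "\<kappa> / \<rho> * (\<phi>\<^sub>0 * \<psi> y\<^sub>0) + U0 + (\<delta> - r - \<rho>) / \<rho> * (y\<^sub>0 - \<phi>\<^sub>0)
      = \<delta> / \<nu> * (y\<^sub>0 - \<phi>\<^sub>0) / \<rho> + U0" by linarith
  then have "u_left y\<^sub>0 = 1 / \<delta> * (\<delta> / \<nu> * (y\<^sub>0 - \<phi>\<^sub>0) / \<rho> + U0)"
    by (simp only: u_left_def \<phi>_y\<^sub>0 G_\<phi>\<^sub>0)
  then show "u_left y\<^sub>0 = u_right y\<^sub>0"
    using pos y\<^sub>0_pos \<nu>_neg by (simp add: u_right_def field_simps)
qed (use assms y\<^sub>0_pos \<phi>_y\<^sub>0 in auto)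

lemma u1_has_derivative:
  assumes "0 < y" shows "(u1 has_real_derivative u2 y) (at y)"
  unfolding u1_def[abs_def] u2_def
proof (rule has_real_derivative_If_le)
  fix y assume y: "0 < y" "y \<le> y\<^sub>0"
  let ?d = "\<phi> y * (1 - \<psi> y) / y"
  have "((\<lambda>y. (y - \<phi> y) / (\<rho> * y)) has_real_derivative
      ((1 - ?d) * (\<rho> * y) - (y - \<phi> y) * (\<rho> * 1)) / ((\<rho> * y) * (\<rho> * y))) (at y within {0<..y\<^sub>0})"
    using y pos by (intro DERIV_divide DERIV_diff DERIV_ident DERIV_cmult \<phi>_has_derivative) auto
  moreover have "((1 - ?d) * (\<rho> * y) - (y - \<phi> y) * (\<rho> * 1)) / ((\<rho> * y) * (\<rho> * y))
      = \<phi> y * \<psi> y / (\<rho> * y\<^sup>2)"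
    using y pos by (simp add: field_simps power2_eq_square)
  ultimately show "((\<lambda>y. (y - \<phi> y) / (\<rho> * y)) has_real_derivative \<phi> y * \<psi> y / (\<rho> * y\<^sup>2))
      (at y within {0<..y\<^sub>0})" by simp
next
  fix y assume "y\<^sub>0 \<le> y"
  then have "0 < y" using y\<^sub>0_pos by simp
  from DERIV_cmult[OF powr_has_derivative[OF this, of "\<nu> - 1"], of "(y\<^sub>0 - \<phi>\<^sub>0) / (\<rho> * y\<^sub>0)"]
  show "((\<lambda>y. (y\<^sub>0 - \<phi>\<^sub>0) / (\<rho> * y\<^sub>0) * (y / y\<^sub>0) powr (\<nu> - 1)) has_real_derivative
      (y\<^sub>0 - \<phi>\<^sub>0) * (\<nu> - 1) / (\<rho> * y\<^sub>0\<^sup>2) * (y / y\<^sub>0) powr (\<nu> - 2)) (at y)"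
    by (simp add: power2_eq_square mult.assoc)
\<comment> \<open>At \<open>y\<^sub>0\<close> the powers equal 1; the values of \<open>u1\<close>
  match by \<open>\<phi>_y\<^sub>0\<close> and its slopes by
  \<open>\<psi>_y\<^sub>0\<close>.\<close>
qed (use assms y\<^sub>0_pos \<phi>_y\<^sub>0 \<psi>_y\<^sub>0 in \<open>auto simp: mult.commute\<close>)

lemma deriv_u: "0 < y \<Longrightarrow> deriv u y = u1 y"
  by (rule DERIV_imp_deriv[OF u_has_derivative])

lemma deriv_u_has_derivative: "0 < y \<Longrightarrow> (deriv u has_real_derivative u2 y) (at y)"
  by (rule has_field_derivative_transform_within_open[OF u1_has_derivative, where S = "{0<..}"])
    (auto simp: deriv_u)

lemma deriv2_u: "0 < y \<Longrightarrow> deriv (deriv u) y = u2 y"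
  by (rule DERIV_imp_deriv[OF deriv_u_has_derivative])

lemma u2_pos: "0 < y \<Longrightarrow> 0 < u2 y"
  using pos y\<^sub>0_pos y\<^sub>0_less \<nu>_neg \<phi>_pos[of y] \<psi>_pos[of y]
  by (simp add: u2_def mult_neg_neg)

section \<open>Behaviour of the derivatives of \<open>u\<close> at 0 and at infinity\<close>

lemma \<phi>_has_derivative_at:
  assumes "0 < y" "y < y\<^sub>0"
  shows "(\<phi> has_real_derivative \<phi> y * (1 - \<psi> y) / y) (at y)"
proof -
  have "at y within {0<..y\<^sub>0} = at y"
    using assms by (intro at_within_interior) simp
  with \<phi>_has_derivative[of y] assms show ?thesis by simp
qed

text \<open>Yields the limit of \<open>u1\<close> at 0, since
  \<open>u1 y = (1 - \<phi> y / y) / \<rho>\<close> there. If \<phi> has a positive limit the claim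
  is immediate. If \<psi> tends to 1, then \<phi> may vanish at 0, but it stays above a multiple of
  \<open>sqrt y\<close>.\<close>

lemma filterlim_\<phi>_over_y: "filterlim (\<lambda>y. \<phi> y / y) at_top (at_right 0)"
proof -
  have y: "\<forall>\<^sub>F y::real in at_right 0. 0 < y"
    by (simp add: eventually_at_right_less)
  consider (lim) L where "0 < L" "(\<phi> \<longlongrightarrow> L) (at_right 0)" | (one) "(\<psi> \<longlongrightarrow> 1) (at_right 0)"
    using triple by (auto simp: dual_triple_def)
  then show ?thesis
  proof cases
    case lim
    from filterlim_tendsto_pos_mult_at_top[OF lim(2,1) filterlim_inverse_at_top_right]
    show ?thesis by (simp add: divide_inverse)
  next
    case one
    have "\<forall>\<^sub>F y in at_right 0. 1 / 2 < \<psi> y"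
      by (rule order_tendstoD(1)[OF one]) simp
    then obtain c where c: "0 < c" "\<And>y. 0 < y \<Longrightarrow> y < c \<Longrightarrow> 1 / 2 < \<psi> y"
      by (auto simp: eventually_at_right_field)
    \<comment> \<open>Below \<open>c\<close> to have \<open>\<psi> > 1 / 2\<close>, and strictly
      below \<open>y\<^sub>0\<close> to have two-sided derivatives of \<phi>.\<close>
    define b where "b = min c y\<^sub>0 / 2"
    have b: "0 < b" "b < c" "b < y\<^sub>0"
      using c(1) y\<^sub>0_pos by (auto simp: b_def min_def)
    define C where "C = \<phi> b / sqrt b"
    have "C > 0" using b \<phi>_pos[of b] by (simp add: C_def)
    \<comment> \<open>\<open>\<phi> / sqrt\<close> is decreasing where \<open>\<psi> \<ge> 1/2\<close>, since \<open>(ln \<phi> - ln y / 2)' = (1/2 - \<psi>) / y\<close>.\<close>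
    have "C / sqrt y \<le> \<phi> y / y" if y: "0 < y" "y \<le> b" for y
    proof -
      have "\<phi> b / sqrt b \<le> \<phi> y / sqrt y"
      proof (rule DERIV_nonpos_imp_nonincreasing[OF y(2)])
        fix z assume z: "y \<le> z" "z \<le> b"
        then have z': "0 < z" "z < y\<^sub>0" "z < c" using y b by auto
        let ?d = "(\<phi> z * (1 - \<psi> z) / z * sqrt z - \<phi> z * (inverse (sqrt z) / 2)) / (sqrt z * sqrt z)"
        have "((\<lambda>y. \<phi> y / sqrt y) has_real_derivative ?d) (at z)"
          using z' by (intro DERIV_divide \<phi>_has_derivative_at DERIV_real_sqrt) auto
        moreover have "?d = \<phi> z * (1 / 2 - \<psi> z) / (sqrt z * sqrt z * sqrt z)"
        proof -
          define t where "t = sqrt z"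
          have "0 < t" "z = t * t" using z' by (simp_all add: t_def)
          then show ?thesis
            unfolding t_def[symmetric] by (simp add: field_simps)
        qed
        moreover have "\<dots> \<le> 0"
          using z' c(2)[of z] \<phi>_pos[of z]
          by (intro divide_nonpos_pos mult_nonneg_nonpos) auto
        ultimately show "\<exists>d. ((\<lambda>y. \<phi> y / sqrt y) has_real_derivative d) (at z) \<and> d \<le> 0"
          by auto
      qed
      then have "C / sqrt y \<le> \<phi> y / sqrt y / sqrt y"
        unfolding C_def using y by (intro divide_right_mono) auto
      with y show ?thesis by simp
    qed
    moreover have "\<forall>\<^sub>F y in at_right 0. y < b"
      using b by (intro order_tendstoD(2)[OF tendsto_ident_at]) auto
    ultimately have "\<forall>\<^sub>F y in at_right 0. C / sqrt y \<le> \<phi> y / y"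
      using y by (auto elim: eventually_elim2)
    moreover have "filterlim (\<lambda>y. C * inverse (sqrt y)) at_top (at_right 0)"
    proof (rule filterlim_tendsto_pos_mult_at_top[OF tendsto_const \<open>C > 0\<close>])
      have "filterlim sqrt (at_right 0) (at_right 0)"
      proof (rule tendsto_imp_filterlim_at_right)
        show "(sqrt \<longlongrightarrow> 0) (at_right 0)"
          using tendsto_real_sqrt[OF tendsto_ident_at[of 0 "{0<..}"]] by simp
        show "\<forall>\<^sub>F x in at_right 0. 0 < sqrt x"
          using y by eventually_elim simp
      qed
      then show "filterlim (\<lambda>y. inverse (sqrt y)) at_top (at_right 0)"
        by (rule filterlim_compose[OF filterlim_inverse_at_top_right])
    qed
    ultimately show ?thesis
      by (auto simp: divide_inverse intro: filterlim_at_top_mono)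
  qed
qed

lemma u1_at_0: "filterlim u1 at_bot (at_right 0)"
proof -
  have "filterlim (\<lambda>y. 1 / \<rho> * (- 1 + \<phi> y / y)) at_top (at_right 0)"
    using pos
    by (intro filterlim_tendsto_pos_mult_at_top[OF tendsto_const]
        filterlim_tendsto_add_at_top[OF tendsto_const] filterlim_\<phi>_over_y) auto
  then have "filterlim (\<lambda>y. - (1 / \<rho> * (- 1 + \<phi> y / y))) at_bot (at_right 0)"
    by (simp add: filterlim_uminus_at_top)
  moreover have "\<forall>\<^sub>F y in at_right 0. - (1 / \<rho> * (- 1 + \<phi> y / y)) = u1 y"
  proof -
    have "\<forall>\<^sub>F y in at_right 0. y < y\<^sub>0"
      using y\<^sub>0_pos by (intro order_tendstoD(2)[OF tendsto_ident_at]) auto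
    moreover have "\<forall>\<^sub>F y::real in at_right 0. 0 < y"
      by (simp add: eventually_at_right_less)
    ultimately show ?thesis
      by eventually_elim (use pos in \<open>simp add: u1_def field_simps\<close>)
  qed
  ultimately show ?thesis
    using filterlim_cong[OF refl refl] by force
qed

lemma powr_at_top:
  assumes "a < 0" shows "((\<lambda>y. (y / y\<^sub>0) powr a) \<longlongrightarrow> 0) at_top"
proof (rule tendsto_neg_powr[OF assms])
  have "filterlim (\<lambda>y. inverse y\<^sub>0 * y) at_top at_top"
    by (rule filterlim_tendsto_pos_mult_at_top[OF tendsto_const _ filterlim_ident])
      (use y\<^sub>0_pos in simp)
  then show "filterlim (\<lambda>y. y / y\<^sub>0) at_top at_top"
    by (simp add: divide_inverse mult.commute)
qed

lemma u1_at_top: "(u1 \<longlongrightarrow> 0) at_top"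
proof (rule Lim_transform_eventually)
  show "((\<lambda>y. (y\<^sub>0 - \<phi>\<^sub>0) / (\<rho> * y\<^sub>0) * (y / y\<^sub>0) powr (\<nu> - 1)) \<longlongrightarrow> 0) at_top"
    using \<nu>_neg by (intro tendsto_mult_right_zero powr_at_top) simp
  show "\<forall>\<^sub>F y in at_top. (y\<^sub>0 - \<phi>\<^sub>0) / (\<rho> * y\<^sub>0) * (y / y\<^sub>0) powr (\<nu> - 1) = u1 y"
    using eventually_gt_at_top[of y\<^sub>0] by eventually_elim (simp add: u1_def)
qed

text \<open>Becomes the boundary condition on \<open>v' / v''\<close> at 0: with
  \<open>y = v' x\<close> this quotient is \<open>- (y * u2 y)\<close>, and \<open>y\<close> tends
  to infinity as \<open>x\<close> decreases to 0.\<close>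

lemma y_u2_at_top: "((\<lambda>y. - (y * u2 y)) \<longlongrightarrow> 0) at_top"
proof (rule Lim_transform_eventually)
  let ?C = "- ((y\<^sub>0 - \<phi>\<^sub>0) * (\<nu> - 1) / (\<rho> * y\<^sub>0))"
  show "((\<lambda>y. ?C * (y / y\<^sub>0) powr (\<nu> - 1)) \<longlongrightarrow> 0) at_top"
    using \<nu>_neg by (intro tendsto_mult_right_zero powr_at_top) simp
  show "\<forall>\<^sub>F y in at_top. ?C * (y / y\<^sub>0) powr (\<nu> - 1) = - (y * u2 y)"
    using eventually_gt_at_top[of y\<^sub>0]
  proof eventually_elim
    case (elim y)
    then have "(y / y\<^sub>0) powr (\<nu> - 1) = (y / y\<^sub>0) * (y / y\<^sub>0) powr (\<nu> - 2)"
      using y\<^sub>0_pos powr_add[of "y / y\<^sub>0" 1 "\<nu> - 2"] by simp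
    with elim show ?case by (simp add: u2_def power2_eq_square ac_simps)
  qed
qed

sublocale convex_dual u
proof
  show "filterlim (deriv u) at_bot (at_right 0)"
    by (rule filterlim_cong[THEN iffD1, OF refl refl _ u1_at_0])
      (auto simp: eventually_at_filter deriv_u)
  show "(deriv u \<longlongrightarrow> 0) at_top"
    by (rule Lim_transform_eventually[OF u1_at_top])
      (use eventually_gt_at_top[of 0] in \<open>eventually_elim, simp add: deriv_u\<close>)
qed (simp_all add: deriv_u deriv2_u u_has_derivative deriv_u_has_derivative u2_pos)

section \<open>The free-boundary problem in the dual variable\<close>

lemma \<phi>_less:
  assumes "0 < y" "y < y\<^sub>0" shows "\<phi> y < \<phi>\<^sub>0"
proof -
  \<comment> \<open>Monotonicity from the sign of the derivative is used only up to
    \<open>?z\<close>, since the derivative of \<phi> at \<open>y\<^sub>0\<close> is one-sided; the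
    weak bound at \<open>?z\<close> finishes.\<close>
  let ?z = "(y + y\<^sub>0) / 2"
  have z: "y < ?z" "?z < y\<^sub>0" using assms by auto
  have "\<phi> y < \<phi> ?z"
  proof (rule DERIV_pos_imp_increasing[OF z(1)])
    fix w assume w: "y \<le> w" "w \<le> ?z"
    then have "0 < w" "w < y\<^sub>0" using assms z by linarith+
    then show "\<exists>d. (\<phi> has_real_derivative d) (at w) \<and> 0 < d"
      using \<phi>_has_derivative_at[of w] \<phi>_pos[of w] \<psi>_less[of w]
      by (intro exI[of _ "\<phi> w * (1 - \<psi> w) / w"] conjI) auto
  qed
  also have "\<phi> ?z \<le> \<phi>\<^sub>0" using \<phi>_le[of ?z] assms z by linarith
  finally show ?thesis .
qed

lemma power_identities:
  assumes "y\<^sub>0 < y"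
  defines "p \<equiv> (y / y\<^sub>0) powr \<nu>"
  shows "y * u1 y = (y\<^sub>0 - \<phi>\<^sub>0) / \<rho> * p" "y\<^sup>2 * u2 y = (y\<^sub>0 - \<phi>\<^sub>0) * (\<nu> - 1) / \<rho> * p"
proof -
  define q where "q = (y / y\<^sub>0) powr (\<nu> - 2)"
  have "p = (y / y\<^sub>0)\<^sup>2 * q"
    using assms y\<^sub>0_pos powr_add[of "y / y\<^sub>0" 2 "\<nu> - 2"] by (simp add: p_def q_def)
  moreover have "(y / y\<^sub>0) powr (\<nu> - 1) = (y / y\<^sub>0) * q"
    using assms y\<^sub>0_pos powr_add[of "y / y\<^sub>0" 1 "\<nu> - 2"] by (simp add: q_def)
  ultimately show "y * u1 y = (y\<^sub>0 - \<phi>\<^sub>0) / \<rho> * p" "y\<^sup>2 * u2 y = (y\<^sub>0 - \<phi>\<^sub>0) * (\<nu> - 1) / \<rho> * p"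
    using assms(1) by (simp_all add: u1_def u2_def power2_eq_square ac_simps flip: q_def)
qed

lemma consumption_left: "0 < y \<Longrightarrow> y \<le> y\<^sub>0 \<Longrightarrow> y - \<rho> * (y * u1 y) = \<phi> y"
  using pos by (simp add: u1_def)

text \<open>On the power branch the right side is \<open>?h y\<close>, with
  \<open>?h y\<^sub>0 = \<phi>\<^sub>0\<close>. As \<nu> is negative, the slope of \<open>?h\<close>
  is smallest at \<open>y\<^sub>0\<close>, and there \<open>y\<^sub>0_lower\<close> makes it
  positive.\<close>

lemma consumption_right:
  assumes "y\<^sub>0 < y" shows "\<phi>\<^sub>0 < y - \<rho> * (y * u1 y)"
proof -
  let ?h = "\<lambda>y. y + (\<phi>\<^sub>0 - y\<^sub>0) * (y / y\<^sub>0) powr \<nu>"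
  have "?h y\<^sub>0 < ?h y"
  proof (rule DERIV_pos_imp_increasing[OF assms])
    fix z assume z: "y\<^sub>0 \<le> z"
    let ?q = "(z / y\<^sub>0) powr (\<nu> - 1)"
    have "(?h has_real_derivative 1 + (\<phi>\<^sub>0 - y\<^sub>0) * (\<nu> / y\<^sub>0 * ?q)) (at z)"
      using z y\<^sub>0_pos by (intro DERIV_add DERIV_ident DERIV_cmult powr_has_derivative) simp
    moreover have "?q \<le> 1"
      using z y\<^sub>0_pos \<nu>_neg powr_mono2'[of "\<nu> - 1" 1 "z / y\<^sub>0"] by simp
    then have "- \<nu> * (\<phi>\<^sub>0 - y\<^sub>0) * ?q \<le> - \<nu> * (\<phi>\<^sub>0 - y\<^sub>0) * 1"
      using \<nu>_neg y\<^sub>0_less by (intro mult_left_mono mult_nonneg_nonneg) auto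
    then have "- \<nu> * (\<phi>\<^sub>0 - y\<^sub>0) * ?q < y\<^sub>0"
      using y\<^sub>0_lower by simp
    then have "0 < 1 + (\<phi>\<^sub>0 - y\<^sub>0) * (\<nu> / y\<^sub>0 * ?q)"
      using y\<^sub>0_pos by (simp add: field_simps)
    ultimately show "\<exists>d. (?h has_real_derivative d) (at z) \<and> 0 < d" by blast
  qed
  moreover have "\<rho> * (y * u1 y) = (y\<^sub>0 - \<phi>\<^sub>0) * (y / y\<^sub>0) powr \<nu>"
    using pos by (simp add: power_identities(1)[OF assms])
  ultimately show ?thesis
    using y\<^sub>0_pos by (simp add: left_diff_distrib)
qed

text \<open>After insertion of the closed forms for \<open>u1\<close> and \<open>u2\<close>, the
  formula defining \<open>u_left\<close> is this equation solved for \<open>\<delta> * u y\<close>.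
  What remains is algebra; the equation for \<psi> was spent on showing that \<open>u1\<close> is
  the derivative.\<close>

lemma dual_equation_left:
  assumes "0 < y" "y \<le> y\<^sub>0"
  shows "\<kappa> * (y\<^sup>2 * u2 y) + G \<alpha> Up (\<phi> y) - (r + \<rho>) * (y * u1 y) - \<delta> * (u y - y * u1 y) = 0"
proof -
  have "y * u1 y = (y - \<phi> y) / \<rho>" "y\<^sup>2 * u2 y = \<phi> y * \<psi> y / \<rho>"
    using assms by (simp_all add: u1_def u2_def)
  moreover have "\<delta> * u y = \<kappa> / \<rho> * (\<phi> y * \<psi> y) + G \<alpha> Up (\<phi> y) + (\<delta> - r - \<rho>) / \<rho> * (y - \<phi> y)"
    using assms pos by (simp add: u_eq u_left_def)
  ultimately have "\<kappa> * (y\<^sup>2 * u2 y) + G \<alpha> Up (\<phi> y) - (r + \<rho>) * (y * u1 y) - \<delta> * (u y - y * u1 y)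
      = \<kappa> * (\<phi> y * \<psi> y / \<rho>) + G \<alpha> Up (\<phi> y) - (r + \<rho>) * ((y - \<phi> y) / \<rho>)
        - (\<kappa> / \<rho> * (\<phi> y * \<psi> y) + G \<alpha> Up (\<phi> y) + (\<delta> - r - \<rho>) / \<rho> * (y - \<phi> y)
          - \<delta> * ((y - \<phi> y) / \<rho>))"
    by (simp only: right_diff_distrib[of \<delta>])
  also have "\<dots> = 0"
    using pos by (simp add: field_simps)
  finally show ?thesis .
qed

text \<open>An Euler equation: the constant \<open>U0 / \<delta>\<close> is a particular solution,
  and the power term is multiplied by the quadratic polynomial that vanishes at \<nu>.\<close>

lemma dual_equation_right:
  assumes "y\<^sub>0 < y"
  shows "\<kappa> * (y\<^sup>2 * u2 y) - (r + \<rho>) * (y * u1 y) - \<delta> * (u y - y * u1 y) + U0 = 0"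
proof -
  define p where "p = (y\<^sub>0 - \<phi>\<^sub>0) / (\<rho> * \<nu>) * (y / y\<^sub>0) powr \<nu>"
  have "y * u1 y = \<nu> * p" "y\<^sup>2 * u2 y = \<nu> * (\<nu> - 1) * p"
    unfolding power_identities[OF assms] p_def using \<nu>_neg pos by (simp_all add: field_simps)
  moreover have "\<delta> * u y = \<delta> * p + U0"
    using assms pos by (simp add: u_eq u_right_def p_def distrib_left)
  ultimately have "\<kappa> * (y\<^sup>2 * u2 y) - (r + \<rho>) * (y * u1 y) - \<delta> * (u y - y * u1 y) + U0
      = \<kappa> * (\<nu> * (\<nu> - 1) * p) - (r + \<rho>) * (\<nu> * p) - (\<delta> * p + U0 - \<delta> * (\<nu> * p)) + U0"
    by (simp only: right_diff_distrib[of \<delta>])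
  also have "\<dots> = (\<kappa> * \<nu> * (\<nu> - 1) - ((r + \<rho> - \<delta>) * \<nu> + \<delta>)) * p"
    by (simp add: algebra_simps)
  finally show ?thesis by (simp add: \<nu>_root)
qed

abbreviation "x\<^sub>0 \<equiv> (\<phi>\<^sub>0 - y\<^sub>0) / (\<rho> * y\<^sub>0)"

lemma deriv_u_y\<^sub>0: "deriv u y\<^sub>0 = - x\<^sub>0"
  using y\<^sub>0_pos by (simp add: deriv_u u1_def \<phi>_y\<^sub>0 minus_divide_left)

lemma x\<^sub>0_pos: "0 < x\<^sub>0"
  using y\<^sub>0_pos y\<^sub>0_less pos by simp

lemma deriv_inv_x\<^sub>0: "deriv_inv u (- x\<^sub>0) = y\<^sub>0"
  using deriv_inv_less_iff[OF x\<^sub>0_pos y\<^sub>0_pos] less_deriv_inv_iff[OF x\<^sub>0_pos y\<^sub>0_pos] deriv_u_y\<^sub>0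
  by simp

end

section \<open>Return to the primal variable by the substitution \<open>y = v' x\<close>\<close>

theorem corollary3p2:
  fixes r \<mu> \<sigma> \<rho> \<delta> \<alpha> c\<^sub>0 \<phi>\<^sub>0 y\<^sub>0 x\<^sub>0 :: real
    and Up Um \<phi> \<psi> u v :: "real \<Rightarrow> real"
  assumes "r \<ge> 0" "\<mu> > 0" "\<sigma> > 0" "\<rho> > 0" "\<delta> > 0" "\<alpha> > 0"
    and "utility Up" "utility Um"
    and A1: "ereal (Um \<alpha>) \<le> ereal \<alpha> * marginal Up 0"
    and A2: "\<exists>a\<^sub>1>0. \<exists>a\<^sub>2>0. \<exists>a\<^sub>3>0. \<exists>a\<^sub>4\<ge>0. \<forall>x>a\<^sub>3.
               Up x \<le> a\<^sub>1 + x * deriv Up x + a\<^sub>2 * deriv Up x powr (- a\<^sub>4)"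
    and c\<^sub>0: "c\<^sub>0 \<ge> \<alpha>"
      "ereal c\<^sub>0 * marginal Up (c\<^sub>0 - \<alpha>) - ereal (Up (c\<^sub>0 - \<alpha>)) = ereal (Um \<alpha>)"
    and \<phi>\<^sub>0: "ereal \<phi>\<^sub>0 = marginal Up (c\<^sub>0 - \<alpha>)"
    and triple: "dual_triple r \<mu> \<sigma> \<rho> \<delta> \<alpha> Up \<phi>\<^sub>0 y\<^sub>0 \<phi> \<psi>"
    and u: "u = dual_value r \<mu> \<sigma> \<rho> \<delta> \<alpha> Up Um \<phi>\<^sub>0 y\<^sub>0 \<phi> \<psi>"
    and v: "v = primal_value u"
    and x\<^sub>0: "x\<^sub>0 = (\<phi>\<^sub>0 - y\<^sub>0) / (\<rho> * y\<^sub>0)"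
  shows
    "(\<forall>x>0. (v has_real_derivative deriv_inv u (- x)) (at x) \<and> deriv v x = deriv_inv u (- x) \<and>
        deriv_inv u (- x) > 0)
     \<and> (\<forall>x>0. (deriv v has_real_derivative - 1 / deriv (deriv u) (deriv v x)) (at x) \<and>
        deriv (deriv v) x = - 1 / deriv (deriv u) (deriv v x) \<and>
        - 1 / deriv (deriv u) (deriv v x) < 0)
     \<and> (\<forall>x. 0 < x \<and> x < x\<^sub>0 \<longrightarrow>
        - (\<mu>\<^sup>2 / (2 * \<sigma>\<^sup>2)) * ((deriv v x)\<^sup>2 / deriv (deriv v) x) + (r + \<rho>) * x * deriv v x
          - \<delta> * v x + S_utility \<alpha> Up Um 0 = 0)
     \<and> (\<forall>x\<ge>x\<^sub>0.
        - (\<mu>\<^sup>2 / (2 * \<sigma>\<^sup>2)) * ((deriv v x)\<^sup>2 / deriv (deriv v) x) + G \<alpha> Up ((1 + \<rho> * x) * deriv v x)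
          + (r + \<rho>) * x * deriv v x - \<delta> * v x = 0)
     \<and> (1 + \<rho> * x\<^sub>0) * deriv v x\<^sub>0 = \<phi>\<^sub>0
     \<and> ((\<lambda>x. deriv v x / deriv (deriv v) x) \<longlongrightarrow> 0) (at_right 0)
     \<and> (\<forall>x. 0 < x \<and> x < x\<^sub>0 \<longrightarrow> (1 + \<rho> * x) * deriv v x > \<phi>\<^sub>0)
     \<and> (\<forall>x>x\<^sub>0. 0 < (1 + \<rho> * x) * deriv v x \<and> (1 + \<rho> * x) * deriv v x < \<phi>\<^sub>0)
     \<and> (deriv v \<longlongrightarrow> 0) at_top
     \<and> filterlim (deriv v) at_top (at_right 0)"
proof -
  interpret dual_problem Up r \<mu> \<sigma> \<rho> \<delta> \<alpha> c\<^sub>0 \<phi>\<^sub>0 y\<^sub>0 Um \<phi> \<psi>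
    by unfold_locales (use assms in auto)
  let ?Y = "\<lambda>x. deriv_inv u (- x)"
  have Y: "0 < ?Y x" "deriv u (?Y x) = - x" "deriv v x = ?Y x"
    "deriv (deriv v) x = - 1 / u2 (?Y x)" "deriv (deriv u) (?Y x) = u2 (?Y x)" if "0 < x" for x
    using deriv_inv_pos[OF that] deriv_deriv_inv[OF that] deriv_primal_value[OF that]
      DERIV_imp_deriv[OF deriv_primal_value_has_derivative[OF that]] deriv2_u
    by (simp_all add: u v)
  have u1_Y: "u1 (?Y x) = - x" if "0 < x" for x
    using Y(1,2)[OF that] deriv_u by (simp add: u)
  have v_Y: "u (?Y x) - ?Y x * u1 (?Y x) = v x" if "0 < x" for x
    by (simp add: v primal_value_def u1_Y[OF that])
  \<comment> \<open>The second derivative of \<open>v\<close> is \<open>- 1 / u2 (?Y x)\<close>, so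
    dividing by it turns the nonlinear term into one linear in \<open>u2\<close>.\<close>
  have quotient: "- (\<mu>\<^sup>2 / (2 * \<sigma>\<^sup>2)) * ((deriv v x)\<^sup>2 / deriv (deriv v) x) = \<kappa> * ((?Y x)\<^sup>2 * u2 (?Y x))"
    if "0 < x" for x
    by (simp add: Y[OF that] \<kappa>_def)
  have consumption: "(1 + \<rho> * x) * deriv v x = ?Y x - \<rho> * (?Y x * u1 (?Y x))" if "0 < x" for x
    by (simp add: Y(3)[OF that] u1_Y[OF that] algebra_simps)
  have x\<^sub>0_pos: "0 < x\<^sub>0" and Y_x\<^sub>0: "?Y x\<^sub>0 = y\<^sub>0"
    using x\<^sub>0_pos deriv_inv_x\<^sub>0 by (simp_all add: x\<^sub>0 u)
  \<comment> \<open>\<open>?Y\<close> is decreasing: points to the left of \<open>x\<^sub>0\<close>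
    belong to the power branch of \<open>u\<close>, points to the right to the branch built from
    \<phi> and \<psi>.\<close>
  have before: "y\<^sub>0 < ?Y x" if "0 < x" "x < x\<^sub>0" for x
    using less_deriv_inv_iff[OF that(1) y\<^sub>0_pos] that(2) deriv_u_y\<^sub>0 by (simp add: u x\<^sub>0)
  have after: "?Y x < y\<^sub>0" if "x\<^sub>0 < x" for x
    using deriv_inv_less_iff[of x, OF _ y\<^sub>0_pos] that x\<^sub>0_pos deriv_u_y\<^sub>0 by (simp add: u x\<^sub>0)
  have from_x\<^sub>0: "0 < x" "?Y x \<le> y\<^sub>0" if "x\<^sub>0 \<le> x" for x
    using that x\<^sub>0_pos after[of x] Y_x\<^sub>0 by (cases "x = x\<^sub>0"; simp)+
  show ?thesis
  proof (intro conjI allI impI; (elim conjE)?)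
    fix x :: real assume x: "0 < x"
    show "(v has_real_derivative ?Y x) (at x)"
      unfolding v u by (rule primal_value_has_derivative[OF x])
    show "deriv v x = ?Y x" "0 < ?Y x" using Y[OF x] by auto
    show "(deriv v has_real_derivative - 1 / deriv (deriv u) (deriv v x)) (at x)"
      unfolding v u by (rule deriv_primal_value_has_derivative[OF x])
    show "deriv (deriv v) x = - 1 / deriv (deriv u) (deriv v x)"
      by (simp add: Y[OF x])
    show "- 1 / deriv (deriv u) (deriv v x) < 0"
      using u2_pos[OF Y(1)[OF x]] by (simp add: Y[OF x])
  next
    fix x assume x: "0 < x" "x < x\<^sub>0"
    show "- (\<mu>\<^sup>2 / (2 * \<sigma>\<^sup>2)) * ((deriv v x)\<^sup>2 / deriv (deriv v) x) + (r + \<rho>) * x * deriv v x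
        - \<delta> * v x + S_utility \<alpha> Up Um 0 = 0"
      using dual_equation_right[OF before[OF x], folded u] unfolding quotient[OF x(1)] v_Y[OF x(1)]
      by (simp add: Y(3)[OF x(1)] u1_Y[OF x(1)] mult_ac)
    show "\<phi>\<^sub>0 < (1 + \<rho> * x) * deriv v x"
      unfolding consumption[OF x(1)] by (rule consumption_right[OF before[OF x]])
  next
    fix x assume "x\<^sub>0 \<le> x"
    note x = from_x\<^sub>0[OF this] and Yx = Y[OF from_x\<^sub>0(1)[OF this]]
    show "- (\<mu>\<^sup>2 / (2 * \<sigma>\<^sup>2)) * ((deriv v x)\<^sup>2 / deriv (deriv v) x) + G \<alpha> Up ((1 + \<rho> * x) * deriv v x)
        + (r + \<rho>) * x * deriv v x - \<delta> * v x = 0"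
      \<comment> \<open>The argument of \<open>G\<close> is rewritten in two stages, first as an
        expression in \<open>?Y x\<close> and \<open>u1\<close>, then as
        \<open>\<phi> (?Y x)\<close>.\<close>
      using dual_equation_left[OF Yx(1) x(2), folded u]
      unfolding quotient[OF x(1)] v_Y[OF x(1)] consumption[OF x(1)] consumption_left[OF Yx(1) x(2)]
      by (simp add: Yx(3) u1_Y[OF x(1)] mult_ac)
  next
    show "(1 + \<rho> * x\<^sub>0) * deriv v x\<^sub>0 = \<phi>\<^sub>0"
      unfolding consumption[OF x\<^sub>0_pos] Y_x\<^sub>0
      using consumption_left[of y\<^sub>0] y\<^sub>0_pos \<phi>_y\<^sub>0 by simp
  next
    show "((\<lambda>x. deriv v x / deriv (deriv v) x) \<longlongrightarrow> 0) (at_right 0)"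
    proof (rule Lim_transform_eventually)
      show "((\<lambda>x. - (?Y x * u2 (?Y x))) \<longlongrightarrow> 0) (at_right 0)"
        using filterlim_compose[OF y_u2_at_top deriv_inv_at_0] by (simp add: u)
      show "\<forall>\<^sub>F x in at_right 0. - (?Y x * u2 (?Y x)) = deriv v x / deriv (deriv v) x"
        by (auto simp: eventually_at_filter Y)
    qed
  next
    fix x assume "x\<^sub>0 < x"
    then have x: "0 < x" "?Y x < y\<^sub>0" using after x\<^sub>0_pos by auto
    note Yx = Y(1)[OF x(1)]
    have eq: "(1 + \<rho> * x) * deriv v x = \<phi> (?Y x)"
      unfolding consumption[OF x(1)] using consumption_left[OF Yx] x(2) by simp
    show "0 < (1 + \<rho> * x) * deriv v x" "(1 + \<rho> * x) * deriv v x < \<phi>\<^sub>0"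
      unfolding eq using \<phi>_pos[OF Yx] \<phi>_less[OF Yx x(2)] x(2) by auto
  next
    show "(deriv v \<longlongrightarrow> 0) at_top"
      unfolding v u by (rule deriv_primal_value_at_top)
    show "filterlim (deriv v) at_top (at_right 0)"
      unfolding v u by (rule deriv_primal_value_at_0)
  qed
qed

end
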